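(* For $(m,p)=(3,3)$ and Schubert data $\alpha^\bullet=(J_2,J_2,J_2,J_2,J_1)$ for $\mathrm{Grass}(3,6)$, where $J_2=(1,2,5)$ and $J_1=(1,2,4)$, one has $d(3,3;\alpha^\bullet)=3$ and property $\mathrm{SG}(3,3;\alpha^\bullet)$ holds.
   Context: Let $n=m+p$. $\mathrm{Grass}(p,n)$ is the Grassmannian of complex $p$-planes in $\mathbb C^n$; a complete flag $K_\bullet$ is a chain $K_1\subset\cdots\subset K_n=\mathbb C^n$, $\dim K_i=i$. A Schubert condition is $\alpha=(1\le\alpha_1<\cdots<\alpha_p\le n)$, $|\alpha|=\sum_i(\alpha_i-i)$, and $\Omega_\alpha K_\bullet=\{X\in\mathrm{Grass}(p,n):\dim(X\cap K_{n+1-\alpha_i})\ge p+1-i\ \forall i\}$. Schubert data: a sequence $(\alpha^1,\dots,\alpha^k)$ with $\sum_j|\alpha^j|=mp$; $d(m,p;\alpha^\bullet)$ is the number of points in $\bigcap_j\Omega_{\alpha^j}F^j_\bullet$ for flags in general position. $K_\bullet(s)$ ($s\in\mathbb C$) is the flag with $K_i(s)$ the row span of the first $i$ rows of the $n\times n$ matrix with $(i,j)$ entry $\binom{j-1}{i-1}s^{j-i}$. Property $\mathrm{SG}(m,p;\alpha^\bullet)$: there is a nonzero real polynomial $f$ in $k$ variables such that for all distinct reals $s_1,\dots,s_k$ with $f(s_1,\dots,s_k)\ne0$, $\bigcap_j\Omega_{\alpha^j}K_\bullet(s_j)$ consists of exactly $d(m,p;\alpha^\bullet)$ points, all real. The Pieri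 condition $J_a$ is $(1,2,\dots,p-1,p+a)$. *)

theory Defs
  imports "HOL-Library.Function_Algebras" "HOL-Analysis.Analysis"
begin

text \<open>Vectors of C^n are modelled as functions nat => complex vanishing outside
  the index range 0..n-1 (coordinate c of the paper is index c-1 here).
  Complex linear algebra is taken from the Vector_Spaces locale with complex scaling.\<close>

definition cscale :: "complex \<Rightarrow> (nat \<Rightarrow> complex) \<Rightarrow> (nat \<Rightarrow> complex)" where
  "cscale c v = (\<lambda>i. c * v i)"

abbreviation cspan :: "(nat \<Rightarrow> complex) set \<Rightarrow> (nat \<Rightarrow> complex) set" where
  "cspan \<equiv> module.span cscale"

abbreviation csubspace :: "(nat \<Rightarrow> complex) set \<Rightarrow> bool" where
  "csubspace \<equiv> module.subspace cscale"

abbreviation cdim :: "(nat \<Rightarrow> complex) set \<Rightarrow> nat" where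
  "cdim \<equiv> vector_space.dim cscale"

definition Cn :: "nat \<Rightarrow> (nat \<Rightarrow> complex) set" where
  "Cn n = {v. \<forall>i\<ge>n. v i = 0}"

definition grass :: "nat \<Rightarrow> nat \<Rightarrow> (nat \<Rightarrow> complex) set set" where
  "grass p n = {X. csubspace X \<and> X \<subseteq> Cn n \<and> cdim X = p}"

definition row_flag :: "nat \<Rightarrow> (nat \<Rightarrow> nat \<Rightarrow> complex) \<Rightarrow> nat \<Rightarrow> (nat \<Rightarrow> complex) set" where
  "row_flag n g i = cspan ((\<lambda>r c. if c < n then g r c else 0) ` {..<i})"

definition invertible_mat :: "nat \<Rightarrow> (nat \<Rightarrow> nat \<Rightarrow> complex) \<Rightarrow> bool" where
  "invertible_mat n g \<longleftrightarrow> cdim (row_flag n g n) = n"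

text \<open>Osculating flag K(s): (i,j) entry (1-based) is binom(j-1,i-1) s^(j-i);
  0-based this is binom(j,i) s^(j-i) (zero for j < i).\<close>
definition osc_flag :: "nat \<Rightarrow> complex \<Rightarrow> nat \<Rightarrow> (nat \<Rightarrow> complex) set" where
  "osc_flag n s = row_flag n (\<lambda>i j. if i \<le> j then of_nat (j choose i) * s ^ (j - i) else 0)"

definition schubert_cond :: "nat \<Rightarrow> nat \<Rightarrow> nat list \<Rightarrow> bool" where
  "schubert_cond p n \<alpha> \<longleftrightarrow> length \<alpha> = p \<and> sorted_wrt (<) \<alpha> \<and> (\<forall>a\<in>set \<alpha>. 1 \<le> a \<and> a \<le> n)"

definition schubert_size :: "nat list \<Rightarrow> nat" where
  "schubert_size \<alpha> = (\<Sum>i<length \<alpha>. \<alpha> ! i - (i + 1))"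

text \<open>Omega_alpha K = {X in Grass(p,n). dim(X cap K_(n+1-alpha_i)) >= p+1-i for all i};
  with 0-based index i this reads dim(X cap K_(n+1-alpha!i)) >= p - i.\<close>
definition schubert_var :: "nat \<Rightarrow> nat \<Rightarrow> nat list \<Rightarrow> (nat \<Rightarrow> (nat \<Rightarrow> complex) set)
    \<Rightarrow> (nat \<Rightarrow> complex) set set" where
  "schubert_var p n \<alpha> K =
     {X \<in> grass p n. \<forall>i<p. cdim (X \<inter> K (n + 1 - \<alpha> ! i)) \<ge> p - i}"

definition pieri :: "nat \<Rightarrow> nat \<Rightarrow> nat list" where
  "pieri p a = [1..<p] @ [p + a]"

inductive poly_fun :: "'v set \<Rightarrow> (('v \<Rightarrow> 'a::comm_ring_1) \<Rightarrow> 'a) \<Rightarrow> bool" for V where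
  pf_const: "poly_fun V (\<lambda>x. c)"
| pf_var: "v \<in> V \<Longrightarrow> poly_fun V (\<lambda>x. x v)"
| pf_add: "poly_fun V f \<Longrightarrow> poly_fun V g \<Longrightarrow> poly_fun V (\<lambda>x. f x + g x)"
| pf_mult: "poly_fun V f \<Longrightarrow> poly_fun V g \<Longrightarrow> poly_fun V (\<lambda>x. f x * g x)"

definition schubert_inter :: "nat \<Rightarrow> nat \<Rightarrow> nat list list \<Rightarrow> (nat \<Rightarrow> nat \<Rightarrow> (nat \<Rightarrow> complex) set)
    \<Rightarrow> (nat \<Rightarrow> complex) set set" where
  "schubert_inter p n \<alpha>s F = grass p n \<inter> (\<Inter>j\<in>{..<length \<alpha>s}. schubert_var p n (\<alpha>s ! j) (F j))"

text \<open>N is the number of points of the intersection for flags in general position: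
  there is a nonzero polynomial P in the entries of k matrices g_0..g_(k-1)
  (flag F^j = row flag of g_j) such that whenever all g_j are invertible and
  P does not vanish, the intersection consists of exactly N points.\<close>
definition generic_count :: "nat \<Rightarrow> nat \<Rightarrow> nat list list \<Rightarrow> nat \<Rightarrow> bool" where
  "generic_count m p \<alpha>s N \<longleftrightarrow>
     (let n = m + p; k = length \<alpha>s in
      \<exists>P :: (nat \<times> nat \<times> nat \<Rightarrow> complex) \<Rightarrow> complex.
        poly_fun ({..<k} \<times> {..<n} \<times> {..<n}) P \<and> (\<exists>x. P x \<noteq> 0) \<and>
        (\<forall>gs :: nat \<Rightarrow> nat \<Rightarrow> nat \<Rightarrow> complex.
           (\<forall>j<k. invertible_mat n (gs j)) \<and> P (\<lambda>(j, a, b). gs j a b) \<noteq> 0 \<longrightarrow>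
           finite (schubert_inter p n \<alpha>s (\<lambda>j. row_flag n (gs j))) \<and>
           card (schubert_inter p n \<alpha>s (\<lambda>j. row_flag n (gs j))) = N))"

definition schubert_d :: "nat \<Rightarrow> nat \<Rightarrow> nat list list \<Rightarrow> nat" where
  "schubert_d m p \<alpha>s = (THE N. generic_count m p \<alpha>s N)"

definition real_point :: "(nat \<Rightarrow> complex) set \<Rightarrow> bool" where
  "real_point X \<longleftrightarrow> (\<exists>B. (\<forall>v\<in>B. \<forall>i. v i \<in> \<real>) \<and> X = cspan B)"

definition SG :: "nat \<Rightarrow> nat \<Rightarrow> nat list list \<Rightarrow> bool" where
  "SG m p \<alpha>s \<longleftrightarrow>
     (let n = m + p; k = length \<alpha>s in
      \<exists>f :: (nat \<Rightarrow> real) \<Rightarrow> real.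
        poly_fun {..<k} f \<and> (\<exists>x. f x \<noteq> 0) \<and>
        (\<forall>s :: nat \<Rightarrow> real. inj_on s {..<k} \<and> f s \<noteq> 0 \<longrightarrow>
           (let I = schubert_inter p n \<alpha>s (\<lambda>j. osc_flag n (complex_of_real (s j))) in
             finite I \<and> card I = schubert_d m p \<alpha>s \<and> (\<forall>X\<in>I. real_point X))))"

end

(* Only the lines K_2 of the first four flags and the 3-space M = K_3 of the fifth matter: X has to meet
   each of them nontrivially.  Write C^6 = L_0 + L_1 + L_2 and split the points of the fourth line along
   this sum.  This gives bases x_i, y_i of L_i such that the fourth line is spanned by the sums of the x_i and
   of the y_i, and the 3-spaces meeting all four lines are exactly the spans X_v of x_i + v y_i (i < 3), with v
   on the projective line.  The condition that X_v meets M is a cubic equation in v.  It has three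
   distinct roots for general flags, because its discriminant does not vanish identically.

   For osculating flags at s_0, ..., s_3 and t = s_4 put h_i = s_i - t.  The relations between the
   four lines are the residue relations of q(z) f(z) / prod (z - h_i)^2 for linear q and deg f < 6, and with
   q = v z - 1 the cubic becomes a nonzero multiple of the derivative of prod (v h_i - 1).  By Rolle it has three
   distinct real roots. *)
theory Submission
  imports Defs "Jordan_Normal_Form.Determinant" "HOL-Computational_Algebra.Fundamental_Theorem_Algebra"
begin

section \<open>Linear algebra over complex scalars\<close>

text \<open>Why a derivative appears: take \<open>t\<close> as origin and P = prod (z - h_i). X_v
  meets M iff some nonzero g of degree at most 2 makes the residues of (v z - 1) z^3 g / P^2 vanish
  at h_0, h_1, h_2, hence also at h_3. The form is then the derivative of some N / P with deg N
  \<le> 4, and after subtraction of a constant its triple zero at 0 forces N to be a multiple of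
  z^4. So for v \<noteq> 0 the point 1/v is critical for z^4 / P, that is, v is critical for prod (1
  - v h_i). The formal proof replaces this argument by explicit determinant identities. Both counts
  use the same pencil lemma but are obtained separately: \<open>schubert_d\<close> is a
  \<open>THE\<close> over generic flags and needs its own existence and uniqueness, while osculating
  flags may lie in the exceptional set of the polynomial that certifies the generic count. Since
  general position must be a polynomial condition on matrix entries, coordinates are taken through
  adjugates and carry a determinant factor instead of being divided by it.\<close>

interpretation cv: vector_space cscale
  by unfold_locales (auto simp: cscale_def fun_eq_iff algebra_simps)

lemma sum_fun_eval: "(\<Sum>r\<in>A. f r) i = (\<Sum>r\<in>A. f r i)"
  for f :: "'b \<Rightarrow> 'c \<Rightarrow> 'a::comm_monoid_add"
  by (induction A rule: infinite_finite_induct) auto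

lemma cscale_apply: "cscale c v i = c * v i"
  by (simp add: cscale_def)

lemma cspan_lessThan:
  fixes n :: nat
  shows "cspan (f ` {..<n}) = {\<Sum>r<n. cscale (c r) (f r) | c. True}"
proof (intro equalityI cv.span_minimal subsetI)
  fix w assume "w \<in> f ` {..<n}"
  then obtain s where s: "s < n" "w = f s" by auto
  have "w = (\<Sum>r<n. cscale (if r = s then 1 else 0) (f r))"
  proof (rule ext)
    fix i
    have "(\<Sum>r<n. (if r = s then 1 else 0) * f r i) = (\<Sum>r<n. if r = s then f s i else 0)"
      by (intro sum.cong) auto
    then show "w i = (\<Sum>r<n. cscale (if r = s then 1 else 0) (f r)) i"
      using s by (simp add: sum_fun_eval cscale_apply)
  qed
  then show "w \<in> {\<Sum>r<n. cscale (c r) (f r) | c. True}"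
    by (intro CollectI exI[of _ "\<lambda>r. if r = s then 1 else 0"]) simp
next
  show "csubspace {\<Sum>r<n. cscale (c r) (f r) | c. True}"
  proof (rule cv.subspaceI)
    show "0 \<in> {\<Sum>r<n. cscale (c r) (f r) | c. True}"
      by (rule CollectI, rule exI[of _ "\<lambda>_. 0"]) simp
  next
    fix x y assume "x \<in> {\<Sum>r<n. cscale (c r) (f r) | c. True}" "y \<in> {\<Sum>r<n. cscale (c r) (f r) | c. True}"
    then obtain c d where "x = (\<Sum>r<n. cscale (c r) (f r))" "y = (\<Sum>r<n. cscale (d r) (f r))" by auto
    then have "x + y = (\<Sum>r<n. cscale (c r + d r) (f r))"
      by (simp add: cv.scale_left_distrib sum.distrib)
    then show "x + y \<in> {\<Sum>r<n. cscale (c r) (f r) | c. True}"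
      by (intro CollectI exI[of _ "\<lambda>r. c r + d r"]) simp
  next
    fix a x assume "x \<in> {\<Sum>r<n. cscale (c r) (f r) | c. True}"
    then obtain c where "x = (\<Sum>r<n. cscale (c r) (f r))" by auto
    then have "cscale a x = (\<Sum>r<n. cscale (a * c r) (f r))"
      by (simp add: cv.scale_sum_right)
    then show "cscale a x \<in> {\<Sum>r<n. cscale (c r) (f r) | c. True}"
      by (intro CollectI exI[of _ "\<lambda>r. a * c r"]) simp
  qed
next
  fix x assume "x \<in> {\<Sum>r<n. cscale (c r) (f r) | c. True}"
  then show "x \<in> cspan (f ` {..<n})"
    by (auto intro!: cv.span_sum cv.span_scale intro: cv.span_base)
qed

text \<open>Independence of the indexed family: a repeated vector counts as a dependence, which it
  would not for the set of values.\<close>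

definition lin_indep :: "nat \<Rightarrow> (nat \<Rightarrow> nat \<Rightarrow> complex) \<Rightarrow> bool" where
  "lin_indep n f \<longleftrightarrow> (\<forall>c. (\<Sum>r<n. cscale (c r) (f r)) = 0 \<longrightarrow> (\<forall>r<n. c r = 0))"

lemma lin_indep_inj: assumes "lin_indep n f" shows "inj_on f {..<n}"
proof (rule inj_onI)
  fix r s assume rs: "r \<in> {..<n}" "s \<in> {..<n}" "f r = f s"
  show "r = s"
  proof (rule ccontr)
    assume ne: "r \<noteq> s"
    define c :: "nat \<Rightarrow> complex" where "c t = (if t = r then 1 else if t = s then -1 else 0)" for t
    have *: "c t * f t i = (if t = r then f r i else 0) + (if t = s then - f r i else 0)" for t i
      using rs ne by (auto simp: c_def)
    have "(\<Sum>t<n. cscale (c t) (f t)) = 0"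
      using rs by (auto simp: fun_eq_iff sum_fun_eval cscale_apply * sum.distrib)
    then have "c r = 0" using assms rs by (auto simp: lin_indep_def)
    then show False by (simp add: c_def)
  qed
qed

lemma lin_indep_independent: assumes "lin_indep n f" shows "cv.independent (f ` {..<n})"
proof -
  have inj: "inj_on f {..<n}" by (rule lin_indep_inj[OF assms])
  have "u w = 0" if u: "(\<Sum>w\<in>f ` {..<n}. cscale (u w) w) = 0" and w: "w \<in> f ` {..<n}" for u w
  proof -
    have "(\<Sum>r<n. cscale (u (f r)) (f r)) = 0"
      using u by (simp add: sum.reindex[OF inj])
    then show ?thesis using assms w by (auto simp: lin_indep_def)
  qed
  then show ?thesis by (subst cv.dependent_finite) auto
qed

lemma cdim_span_lin_indep: "lin_indep n f \<Longrightarrow> cdim (cspan (f ` {..<n})) = n"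
  using lin_indep_inj[of n f] lin_indep_independent[of n f]
  by (simp add: cv.dim_eq_card_independent card_image)

text \<open>\<open>cdim\<close> is the cardinality of a basis, hence 0 for an infinite one, and the
  space of all functions on \<open>nat\<close> allows that. The finite spanning set \<open>T\<close>
  excludes this default value.\<close>

lemma lin_indep_le_cdim:
  assumes "lin_indep n f" "\<And>r. r < n \<Longrightarrow> f r \<in> W" "W \<subseteq> cspan T" "finite T"
  shows "n \<le> cdim W"
proof -
  obtain B where B: "B \<subseteq> W" "cv.independent B" "W \<subseteq> cspan B" "card B = cdim W"
    by (rule cv.basis_exists)
  have "finite B" using cv.independent_span_bound[OF assms(4) B(2)] B(1) assms(3) by blast
  from cv.independent_span_bound[OF this lin_indep_independent[OF assms(1)]]
  have "card (f ` {..<n}) \<le> card B" using assms(2) B(3) by blast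
  then show ?thesis using B(4) lin_indep_inj[OF assms(1)] by (simp add: card_image)
qed

text \<open>An infinite basis has \<open>card\<close> 0, so positive dimension already forces
  finiteness.\<close>

lemma subspace_finite_basis:
  assumes "cdim X > 0"
  obtains B where "finite B" "B \<subseteq> X" "cv.independent B" "X \<subseteq> cspan B" "card B = cdim X"
proof -
  obtain B where B: "B \<subseteq> X" "cv.independent B" "X \<subseteq> cspan B" "card B = cdim X"
    by (rule cv.basis_exists)
  then have "finite B" using assms card_ge_0_finite by metis
  with B show ?thesis using that by blast
qed

lemma lin_indep_spans:
  assumes X: "csubspace X" "cdim X = n" "n > 0" and f: "lin_indep n f" "\<And>r. r < n \<Longrightarrow> f r \<in> X"
  shows "X = cspan (f ` {..<n})"
proof
  show "cspan (f ` {..<n}) \<subseteq> X" using X f by (intro cv.span_minimal) auto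
  show "X \<subseteq> cspan (f ` {..<n})"
  proof
    fix w assume w: "w \<in> X"
    show "w \<in> cspan (f ` {..<n})"
    proof (rule ccontr)
      assume n: "w \<notin> cspan (f ` {..<n})"
      then have i: "cv.independent (insert w (f ` {..<n}))"
        using lin_indep_independent[OF f(1)] by (rule cv.independent_insertI)
      obtain B where B: "finite B" "B \<subseteq> X" "cv.independent B" "X \<subseteq> cspan B" "card B = cdim X"
        using subspace_finite_basis X by metis
      have "card (insert w (f ` {..<n})) \<le> card B"
        using cv.independent_span_bound[OF B(1) i] w f(2) B(4) by auto
      moreover have "w \<notin> f ` {..<n}" using n cv.span_base[of w "f ` {..<n}"] by auto
      ultimately show False using B(5) X lin_indep_inj[OF f(1)] by (simp add: card_image)
    qed
  qed
qed

lemma cdim_pos_iff: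
  assumes "W \<subseteq> cspan T" "finite T"
  shows "1 \<le> cdim W \<longleftrightarrow> (\<exists>w\<in>W. w \<noteq> 0)"
proof
  assume "1 \<le> cdim W"
  then obtain B where B: "finite B" "B \<subseteq> W" "cv.independent B" "card B = cdim W"
    by (metis One_nat_def Suc_le_eq subspace_finite_basis)
  have "B \<noteq> {}" using B(4) \<open>1 \<le> cdim W\<close> by auto
  then obtain b where b: "b \<in> B" by blast
  then have "b \<noteq> 0" using B(3) cv.dependent_zero[of B] by auto
  then show "\<exists>w\<in>W. w \<noteq> 0" using b B(2) by auto
next
  assume "\<exists>w\<in>W. w \<noteq> 0"
  then obtain w where w: "w \<in> W" "w \<noteq> 0" by blast
  then have "lin_indep 1 (\<lambda>_. w)" by (simp add: lin_indep_def cscale_apply)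
  then show "1 \<le> cdim W" using lin_indep_le_cdim[of 1 "\<lambda>_. w" W T] assms w by auto
qed

text \<open>A basis of the kernel together with one vector \<open>b\<close> outside it spans
  \<open>X\<close>. This allows linear equations to be imposed one at a time.\<close>

lemma cdim_hyperplane:
  assumes X: "csubspace X" "cdim X = Suc p"
    and \<psi>: "\<And>v w. \<psi> (v + w) = \<psi> v + \<psi> w" "\<And>c v. \<psi> (cscale c v) = c * \<psi> v"
  shows "p \<le> cdim {w\<in>X. \<psi> w = 0}"
proof (cases "\<exists>b\<in>X. \<psi> b \<noteq> 0")
  case False
  then have "{w\<in>X. \<psi> w = 0} = X" by auto
  then show ?thesis using X by simp
next
  case True
  then obtain b where b: "b \<in> X" "\<psi> b \<noteq> 0" by blast
  let ?W = "{w\<in>X. \<psi> w = 0}"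
  obtain B where B: "B \<subseteq> ?W" "cv.independent B" "?W \<subseteq> cspan B" "card B = cdim ?W"
    by (rule cv.basis_exists)
  obtain T where T: "finite T" "X \<subseteq> cspan T"
    using subspace_finite_basis[of X] X by (metis zero_less_Suc)
  have fB: "finite B" using cv.independent_span_bound[OF T(1) B(2)] B(1) T by blast
  have "x \<in> cspan (insert b B)" if x: "x \<in> X" for x
  proof -
    let ?k = "- \<psi> x / \<psi> b"
    have "\<psi> (x + cscale ?k b) = 0" using b by (simp only: \<psi>) simp
    moreover have "x + cscale ?k b \<in> X" using X x b by (intro cv.subspace_add cv.subspace_scale)
    ultimately have "x + cscale ?k b \<in> cspan (insert b B)"
      using B(3) cv.span_mono[of B "insert b B"] by blast
    moreover have "cscale ?k b \<in> cspan (insert b B)" by (intro cv.span_scale cv.span_base) simp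
    ultimately have "(x + cscale ?k b) - cscale ?k b \<in> cspan (insert b B)" by (rule cv.span_diff)
    then show ?thesis by simp
  qed
  then have "Suc p \<le> card (insert b B)" using cv.dim_le_card[of X "insert b B"] X fB by auto
  also have "\<dots> \<le> Suc (card B)" by (simp add: card_insert_if fB)
  finally show ?thesis using B by simp
qed

section \<open>Coordinates with respect to the rows of an invertible matrix\<close>

definition nmat_det :: "nat \<Rightarrow> (nat \<Rightarrow> nat \<Rightarrow> 'a::comm_ring_1) \<Rightarrow> 'a" where
  "nmat_det n g = Determinant.det (Matrix.mat n n (\<lambda>(i, j). g i j))"

definition nmat_adj :: "nat \<Rightarrow> (nat \<Rightarrow> nat \<Rightarrow> 'a::comm_ring_1) \<Rightarrow> nat \<Rightarrow> nat \<Rightarrow> 'a" where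
  "nmat_adj n g i j = adj_mat (Matrix.mat n n (\<lambda>(i, j). g i j)) $$ (i, j)"

lemma nmat_adj_left:
  assumes "i < n" "k < n"
  shows "(\<Sum>j<n. nmat_adj n g i j * g j k) = (if i = k then nmat_det n g else 0)"
proof -
  let ?A = "Matrix.mat n n (\<lambda>(i, j). g i j)"
  have A: "?A \<in> carrier_mat n n" by simp
  have "(adj_mat ?A * ?A) $$ (i, k) = (\<Sum>j<n. nmat_adj n g i j * g j k)"
    using assms adj_mat(1)[OF A]
    by (auto simp: scalar_prod_def nmat_adj_def atLeast0LessThan intro!: sum.cong)
  then show ?thesis using adj_mat(3)[OF A] assms by (auto simp: nmat_det_def)
qed

lemma nmat_adj_right:
  assumes "i < n" "k < n"
  shows "(\<Sum>j<n. g i j * nmat_adj n g j k) = (if i = k then nmat_det n g else 0)"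
proof -
  let ?A = "Matrix.mat n n (\<lambda>(i, j). g i j)"
  have A: "?A \<in> carrier_mat n n" by simp
  have "(?A * adj_mat ?A) $$ (i, k) = (\<Sum>j<n. g i j * nmat_adj n g j k)"
    using assms adj_mat(1)[OF A]
    by (auto simp: scalar_prod_def nmat_adj_def atLeast0LessThan intro!: sum.cong)
  then show ?thesis using adj_mat(2)[OF A] assms by (auto simp: nmat_det_def)
qed

text \<open>The coordinate of $w$ with respect to row $k$, multiplied by the determinant to make it
  polynomial in the entries of $g$.\<close>
definition row_coord :: "nat \<Rightarrow> (nat \<Rightarrow> nat \<Rightarrow> complex) \<Rightarrow> nat \<Rightarrow> (nat \<Rightarrow> complex) \<Rightarrow> complex" where
  "row_coord n g k w = (\<Sum>j<n. w j * nmat_adj n g j k)"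

abbreviation trunc_row :: "nat \<Rightarrow> (nat \<Rightarrow> nat \<Rightarrow> complex) \<Rightarrow> nat \<Rightarrow> nat \<Rightarrow> complex" where
  "trunc_row n g \<equiv> (\<lambda>r c. if c < n then g r c else 0)"

lemma row_coord_add: "row_coord n g k (v + w) = row_coord n g k v + row_coord n g k w"
  by (simp add: row_coord_def algebra_simps sum.distrib)

lemma row_coord_scale: "row_coord n g k (cscale c v) = c * row_coord n g k v"
  by (simp add: row_coord_def cscale_apply algebra_simps sum_distrib_left)

lemma row_coord_sum: "row_coord n g k (\<Sum>r\<in>A. f r) = (\<Sum>r\<in>A. row_coord n g k (f r))"
  by (simp add: row_coord_def sum_fun_eval sum_distrib_right) (rule sum.swap)

lemma row_coord_row:
  "r < n \<Longrightarrow> k < n \<Longrightarrow> row_coord n g k (trunc_row n g r) = (if r = k then nmat_det n g else 0)"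
  using nmat_adj_right[of r n k g] by (simp add: row_coord_def)

lemma row_coord_comb:
  assumes "i \<le> n" "k < n"
  shows "row_coord n g k (\<Sum>r<i. cscale (c r) (trunc_row n g r)) = (if k < i then c k * nmat_det n g else 0)"
proof -
  have "row_coord n g k (\<Sum>r<i. cscale (c r) (trunc_row n g r)) = (\<Sum>r<i. if r = k then c k * nmat_det n g else 0)"
    unfolding row_coord_sum row_coord_scale
    by (rule sum.cong) (use assms in \<open>auto simp: row_coord_row\<close>)
  then show ?thesis by simp
qed

lemma row_expansion:
  assumes "w \<in> Cn n"
  shows "cscale (nmat_det n g) w = (\<Sum>r<n. cscale (row_coord n g r w) (trunc_row n g r))"
proof
  fix i
  show "cscale (nmat_det n g) w i = (\<Sum>r<n. cscale (row_coord n g r w) (trunc_row n g r)) i"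
  proof (cases "i < n")
    case False
    then show ?thesis using assms by (simp add: sum_fun_eval cscale_apply Cn_def)
  next
    case True
    have "(\<Sum>r<n. row_coord n g r w * g r i) = (\<Sum>j<n. w j * (\<Sum>r<n. nmat_adj n g j r * g r i))"
      by (simp add: row_coord_def sum_distrib_right sum_distrib_left mult.assoc) (rule sum.swap)
    also have "\<dots> = (\<Sum>j<n. if j = i then w i * nmat_det n g else 0)"
      using True by (intro sum.cong) (auto simp: nmat_adj_left)
    finally show ?thesis using True by (simp add: sum_fun_eval cscale_apply mult.commute)
  qed
qed

lemma lin_indep_rows:
  assumes "nmat_det n g \<noteq> 0" "i \<le> n"
  shows "lin_indep i (trunc_row n g)"
  unfolding lin_indep_def
proof (intro allI impI)
  fix c r assume c: "(\<Sum>r<i. cscale (c r) (trunc_row n g r)) = 0" and r: "r < i"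
  have "row_coord n g r (\<Sum>r<i. cscale (c r) (trunc_row n g r)) = c r * nmat_det n g"
    using assms r by (subst row_coord_comb) auto
  then show "c r = 0" using c assms by (simp add: row_coord_def)
qed

lemma cdim_row_flag:
  "nmat_det n g \<noteq> 0 \<Longrightarrow> i \<le> n \<Longrightarrow> cdim (row_flag n g i) = i"
  unfolding row_flag_def by (rule cdim_span_lin_indep[OF lin_indep_rows])

lemma invertible_mat_if_det: "nmat_det n g \<noteq> 0 \<Longrightarrow> Defs.invertible_mat n g"
  by (simp add: Defs.invertible_mat_def cdim_row_flag)

lemma csubspace_Cn: "csubspace (Cn n)"
  by (rule cv.subspaceI) (auto simp: Cn_def cscale_apply)

text \<open>Turns membership in a flag into linear equations. The row expansion describes
  \<open>w\<close> only after multiplication by the determinant, which is divided out at the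
  end.\<close>

lemma row_flag_eq_coords:
  assumes "nmat_det n g \<noteq> 0" "i \<le> n"
  shows "row_flag n g i = {w \<in> Cn n. \<forall>k. i \<le> k \<and> k < n \<longrightarrow> row_coord n g k w = 0}"
proof (intro equalityI subsetI)
  fix w assume "w \<in> row_flag n g i"
  then obtain c where w: "w = (\<Sum>r<i. cscale (c r) (trunc_row n g r))"
    unfolding row_flag_def cspan_lessThan by auto
  then show "w \<in> {w \<in> Cn n. \<forall>k. i \<le> k \<and> k < n \<longrightarrow> row_coord n g k w = 0}"
    using assms by (auto simp: row_coord_comb Cn_def sum_fun_eval cscale_apply)
next
  fix w assume w: "w \<in> {w \<in> Cn n. \<forall>k. i \<le> k \<and> k < n \<longrightarrow> row_coord n g k w = 0}"
  let ?D = "nmat_det n g"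
  have "cscale ?D w = (\<Sum>r<n. cscale (row_coord n g r w) (trunc_row n g r))"
    using w by (intro row_expansion) auto
  also have "\<dots> = (\<Sum>r<i. cscale (row_coord n g r w) (trunc_row n g r))"
    using w assms by (intro sum.mono_neutral_right) auto
  finally have "cscale ?D w \<in> row_flag n g i"
    unfolding row_flag_def cspan_lessThan
    by (intro CollectI exI[of _ "\<lambda>r. row_coord n g r w"]) simp
  then have "cscale (1 / ?D) (cscale ?D w) \<in> row_flag n g i"
    unfolding row_flag_def by (rule cv.span_scale)
  then show "w \<in> row_flag n g i" using assms by simp
qed

lemma row_flag_full: "nmat_det n g \<noteq> 0 \<Longrightarrow> row_flag n g n = Cn n"
  by (auto simp: row_flag_eq_coords)

text \<open>Passing from \<open>n - i\<close> to \<open>n - Suc i\<close> imposes one more row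
  coordinate, which costs at most one dimension.\<close>

lemma cdim_Int_row_flag:
  assumes D: "nmat_det n g \<noteq> 0" and X: "csubspace X" "X \<subseteq> Cn n"
  shows "i \<le> n \<Longrightarrow> cdim X - i \<le> cdim (X \<inter> row_flag n g (n - i))"
proof (induction i)
  case 0
  have "X \<inter> Cn n = X" using X by blast
  then show ?case by (simp add: row_flag_full[OF D])
next
  case (Suc i)
  let ?Y = "X \<inter> row_flag n g (n - i)"
  have IH: "cdim X - i \<le> cdim ?Y" using Suc by simp
  show ?case
  proof (cases "cdim ?Y")
    case 0
    then show ?thesis using IH by simp
  next
    case (Suc q)
    have "csubspace ?Y" using X(1) by (auto simp: row_flag_def intro: cv.subspace_inter)
    then have "q \<le> cdim {w \<in> ?Y. row_coord n g (n - Suc i) w = 0}"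
      using Suc by (rule cdim_hyperplane) (rule row_coord_add, rule row_coord_scale)
    also have "{w \<in> ?Y. row_coord n g (n - Suc i) w = 0} = X \<inter> row_flag n g (n - Suc i)"
    proof -
      have "n - Suc i \<le> k \<and> k < n \<longleftrightarrow> n - i \<le> k \<and> k < n \<or> k = n - Suc i" for k
        using \<open>Suc i \<le> n\<close> by auto
      then show ?thesis by (auto simp: row_flag_eq_coords[OF D])
    qed
    finally show ?thesis using IH Suc by simp
  qed
qed

text \<open>For \<open>i < p - 1\<close> the entry is \<open>i + 1\<close>, and the condition on the
  flag member of dimension \<open>n - i\<close> holds by codimension. Only the entry
  \<open>p + a\<close> restricts \<open>X\<close>, through the member of dimension
  \<open>n + 1 - (p + a) = m + 1 - a\<close>.\<close>

lemma schubert_var_pieri_iff: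
  assumes D: "nmat_det (m + p) g \<noteq> 0" and X: "X \<in> grass p (m + p)" and p: "0 < p" and a: "a \<le> m"
  shows "X \<in> schubert_var p (m + p) (pieri p a) (row_flag (m + p) g) \<longleftrightarrow>
    (\<exists>w \<in> X \<inter> row_flag (m + p) g (m + 1 - a). w \<noteq> 0)"
proof -
  let ?n = "m + p"
  have X': "csubspace X" "X \<subseteq> Cn ?n" "cdim X = p" using X by (auto simp: grass_def)
  obtain B where B: "finite B" "X \<subseteq> cspan B"
    using subspace_finite_basis X'(3) p by metis
  have nth: "pieri p a ! i = (if i = p - 1 then p + a else i + 1)" if "i < p" for i
    using that by (auto simp: pieri_def nth_append)
  have "p - i \<le> cdim (X \<inter> row_flag ?n g (?n + 1 - pieri p a ! i)) \<longleftrightarrow>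
     (i = p - 1 \<longrightarrow> 1 \<le> cdim (X \<inter> row_flag ?n g (m + 1 - a)))" if "i < p" for i
  proof (cases "i = p - 1")
    case True
    then show ?thesis using that nth[OF that] by simp
  next
    case False
    then show ?thesis using nth[OF that] cdim_Int_row_flag[OF D X'(1,2), of i] that X'(3) by simp
  qed
  then have "X \<in> schubert_var p ?n (pieri p a) (row_flag ?n g) \<longleftrightarrow>
      1 \<le> cdim (X \<inter> row_flag ?n g (m + 1 - a))"
    using X p by (auto simp: schubert_var_def)
  also have "\<dots> \<longleftrightarrow> (\<exists>w \<in> X \<inter> row_flag ?n g (m + 1 - a). w \<noteq> 0)"
    using B by (intro cdim_pos_iff) auto
  finally show ?thesis .
qed

section \<open>Subspaces spanned by a pencil\<close>

definition span2 :: "(nat \<Rightarrow> complex) \<Rightarrow> (nat \<Rightarrow> complex) \<Rightarrow> (nat \<Rightarrow> complex) set" where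
  "span2 v w = {z. \<exists>a b. z = cscale a v + cscale b w}"

text \<open>Homogeneous parameters keep the member at infinity, \<open>u = 0\<close>, until a
  nonzero leading coefficient excludes it.\<close>

definition pencil :: "(nat \<Rightarrow> nat \<Rightarrow> complex) \<Rightarrow> (nat \<Rightarrow> nat \<Rightarrow> complex) \<Rightarrow> complex \<Rightarrow> complex \<Rightarrow> nat \<Rightarrow> nat \<Rightarrow> complex" where
  "pencil x y u v i = cscale u (x i) + cscale v (y i)"

text \<open>Equivalently, each span of \<open>x i\<close> and \<open>y i\<close> is two-dimensional
  and the sum of these \<open>p\<close> spans is direct.\<close>

definition pair_indep :: "nat \<Rightarrow> (nat \<Rightarrow> nat \<Rightarrow> complex) \<Rightarrow> (nat \<Rightarrow> nat \<Rightarrow> complex) \<Rightarrow> bool" where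
  "pair_indep p x y \<longleftrightarrow> (\<forall>a b. (\<Sum>i<p. cscale (a i) (x i) + cscale (b i) (y i)) = 0 \<longrightarrow>
     (\<forall>i<p. a i = 0 \<and> b i = 0))"

lemma pair_indepD:
  assumes "pair_indep p x y" "(\<Sum>i<p. cscale (a i) (x i) + cscale (b i) (y i)) = 0" "i < p"
  shows "a i = 0" "b i = 0"
  using assms unfolding pair_indep_def by blast+

lemma pair_indep_eqD:
  assumes "pair_indep p x y" "i < p"
    and eq: "(\<Sum>i<p. cscale (a i) (x i) + cscale (b i) (y i)) = (\<Sum>i<p. cscale (a' i) (x i) + cscale (b' i) (y i))"
  shows "a i = a' i" "b i = b' i"
proof -
  have "(\<Sum>i<p. cscale (a i - a' i) (x i) + cscale (b i - b' i) (y i)) =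
     (\<Sum>i<p. cscale (a i) (x i) + cscale (b i) (y i)) - (\<Sum>i<p. cscale (a' i) (x i) + cscale (b' i) (y i))"
    by (simp add: sum_subtractf [symmetric] cv.scale_left_diff_distrib algebra_simps)
  also have "\<dots> = 0" by (simp only: eq diff_self)
  finally show "a i = a' i" "b i = b' i"
    using pair_indepD[OF assms(1) _ assms(2), of "\<lambda>i. a i - a' i" "\<lambda>i. b i - b' i"] by auto
qed

lemma comb_pairs:
  "cscale c (cscale a v + cscale b w) = cscale (c * a) v + cscale (c * b) w"
  by (simp add: cv.scale_right_distrib)

lemma lin_indep_pairs:
  assumes ind: "pair_indep p x y" and nz: "\<And>i. i < p \<Longrightarrow> a i \<noteq> 0 \<or> b i \<noteq> 0"
  shows "lin_indep p (\<lambda>i. cscale (a i) (x i) + cscale (b i) (y i))"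
  unfolding lin_indep_def comb_pairs
proof (intro allI impI)
  fix c i assume c: "(\<Sum>r<p. cscale (c r * a r) (x r) + cscale (c r * b r) (y r)) = 0" and i: "i < p"
  show "c i = 0" using pair_indepD[OF ind c i] nz[OF i] by auto
qed

lemma lin_indep_pencil:
  "pair_indep p x y \<Longrightarrow> u \<noteq> 0 \<or> v \<noteq> 0 \<Longrightarrow> lin_indep p (pencil x y u v)"
  unfolding pencil_def by (rule lin_indep_pairs) auto

lemma sum_pencil:
  "(\<Sum>i<p. pencil x y u v i) = cscale u (\<Sum>i<p. x i) + cscale v (\<Sum>i<p. y i)"
  by (simp add: pencil_def sum.distrib cv.scale_sum_right)

text \<open>One nonzero vector \<open>z i\<close> of \<open>X\<close> from each summand gives a
  basis of \<open>X\<close>. A vector of \<open>X\<close> on the last line is a combination of the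
  \<open>z i\<close>; comparing components in the direct sum, each of its parts is a multiple of
  \<open>z i\<close>, so the parts lie in \<open>X\<close> and span it.\<close>

lemma span_pencil_cases:
  assumes ind: "pair_indep p x y" and p: "p > 0"
    and X: "csubspace X" "cdim X = p"
    and m: "\<And>i. i < p \<Longrightarrow> \<exists>w \<in> X \<inter> span2 (x i) (y i). w \<noteq> 0"
    and m': "\<exists>w \<in> X \<inter> span2 (\<Sum>i<p. x i) (\<Sum>i<p. y i). w \<noteq> 0"
  obtains u v where "u \<noteq> 0 \<or> v \<noteq> 0" "X = cspan (pencil x y u v ` {..<p})"
proof -
  have "\<forall>i. \<exists>a b. i < p \<longrightarrow> cscale a (x i) + cscale b (y i) \<in> X \<and> cscale a (x i) + cscale b (y i) \<noteq> 0"
    using m unfolding span2_def by fastforce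
  then obtain a b where ab: "\<And>i. i < p \<Longrightarrow> cscale (a i) (x i) + cscale (b i) (y i) \<in> X"
     "\<And>i. i < p \<Longrightarrow> cscale (a i) (x i) + cscale (b i) (y i) \<noteq> 0"
    by metis
  define z where "z i = cscale (a i) (x i) + cscale (b i) (y i)" for i
  have "lin_indep p z" unfolding z_def
    by (rule lin_indep_pairs[OF ind]) (use ab(2) in force)
  then have Xz: "X = cspan (z ` {..<p})"
    by (rule lin_indep_spans[OF X p]) (simp add: z_def ab)
  obtain u v where uv: "cscale u (\<Sum>i<p. x i) + cscale v (\<Sum>i<p. y i) \<in> X"
      "cscale u (\<Sum>i<p. x i) + cscale v (\<Sum>i<p. y i) \<noteq> 0"
    using m' unfolding span2_def by auto
  then have nz: "u \<noteq> 0 \<or> v \<noteq> 0" by auto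
  obtain c where "cscale u (\<Sum>i<p. x i) + cscale v (\<Sum>i<p. y i) = (\<Sum>i<p. cscale (c i) (z i))"
    using uv(1) Xz unfolding cspan_lessThan by auto
  then have eq: "(\<Sum>i<p. cscale u (x i) + cscale v (y i)) = (\<Sum>i<p. cscale (c i * a i) (x i) + cscale (c i * b i) (y i))"
    unfolding z_def comb_pairs by (simp add: sum.distrib cv.scale_sum_right)
  have "pencil x y u v i \<in> X" if i: "i < p" for i
  proof -
    have "pencil x y u v i = cscale (c i) (z i)"
      using pair_indep_eqD[OF ind i eq] by (simp add: pencil_def z_def comb_pairs)
    then show ?thesis using ab(1)[OF i] X by (simp add: z_def cv.subspace_scale)
  qed
  then have "X = cspan (pencil x y u v ` {..<p})"
    by (rule lin_indep_spans[OF X p lin_indep_pencil[OF ind nz]])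
  with nz show ?thesis by (rule that)
qed

text \<open>The component in the summand of index 0 recovers \<open>v\<close>.\<close>

lemma inj_span_pencil:
  assumes ind: "pair_indep p x y" and p: "p > 0"
    and eq: "cspan (pencil x y 1 v ` {..<p}) = cspan (pencil x y 1 v' ` {..<p})"
  shows "v = v'"
proof -
  have "pencil x y 1 v 0 \<in> cspan (pencil x y 1 v' ` {..<p})"
    using eq p cv.span_base[of "pencil x y 1 v 0" "pencil x y 1 v ` {..<p}"] by auto
  then obtain c where c: "pencil x y 1 v 0 = (\<Sum>i<p. cscale (c i) (pencil x y 1 v' i))"
    unfolding cspan_lessThan by auto
  have "(\<Sum>i<p. cscale (if i = 0 then 1 else 0) (x i) + cscale (if i = 0 then v else 0) (y i)) =
    (\<Sum>i<p. if i = 0 then pencil x y 1 v i else 0)"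
    by (intro sum.cong) (auto simp: pencil_def)
  also have "\<dots> = pencil x y 1 v 0" using p by simp
  also have "\<dots> = (\<Sum>i<p. cscale (c i) (x i) + cscale (c i * v') (y i))"
    by (subst c) (simp add: pencil_def cv.scale_right_distrib)
  finally have eq: "(\<Sum>i<p. cscale (if i = 0 then 1 else 0) (x i) + cscale (if i = 0 then v else 0) (y i)) =
    (\<Sum>i<p. cscale (c i) (x i) + cscale (c i * v') (y i))" .
  show ?thesis using pair_indep_eqD[OF ind p eq] by simp
qed

section \<open>Meeting a 3-space as the vanishing of a 3 by 3 determinant\<close>

lemma all_less_3: "(\<forall>k<3::nat. P k) \<longleftrightarrow> P 0 \<and> P 1 \<and> P 2"
  by (auto simp: numeral_3_eq_3 numeral_2_eq_2 less_Suc_eq)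

lemma ex_less_3: "(\<exists>k<3::nat. P k) \<longleftrightarrow> P 0 \<or> P 1 \<or> P 2"
  by (auto simp: numeral_3_eq_3 numeral_2_eq_2 less_Suc_eq)

lemma sum_less_3: "(\<Sum>i<3::nat. f i) = f 0 + f 1 + f 2"
  for f :: "nat \<Rightarrow> 'a::comm_monoid_add"
  by (simp add: numeral_3_eq_3 numeral_2_eq_2 add.assoc)

text \<open>Written out so that Groebner bases and the closure rules of \<open>poly_fun\<close>
  apply directly.\<close>

definition det3 :: "(nat \<Rightarrow> nat \<Rightarrow> 'a::comm_ring_1) \<Rightarrow> 'a" where
  "det3 m = m 0 0 * m 1 1 * m 2 2 + m 0 1 * m 1 2 * m 2 0 + m 0 2 * m 1 0 * m 2 1
    - m 0 0 * m 1 2 * m 2 1 - m 0 1 * m 1 0 * m 2 2 - m 0 2 * m 1 1 * m 2 0"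

lemma det3_eq_0_iff:
  fixes m :: "nat \<Rightarrow> nat \<Rightarrow> complex"
  shows "det3 m = 0 \<longleftrightarrow> (\<exists>c. (\<exists>i<3. c i \<noteq> 0) \<and> (\<forall>k<3. (\<Sum>i<3. c i * m i k) = 0))"
proof -
  \<comment> \<open>The elements 1, 2, 3 of the index type stand for the indices 0, 1, 2. The matrix
    is transposed, so its kernel consists of the coefficients of row relations of
    \<open>m\<close>.\<close>
  let ?A = "(\<chi> k i. m (if i = 1 then 0 else if i = 2 then 1 else 2) (if k = 1 then 0 else if k = 2 then 1 else 2)) :: complex^3^3"
  have d: "Determinants.det ?A = det3 m"
    by (simp add: det_3 det3_def algebra_simps)
  have "det3 m = 0 \<longleftrightarrow> (\<exists>z. ?A *v z = 0 \<and> z \<noteq> 0)"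
    unfolding d [symmetric] using invertible_det_nz[of ?A] matrix_left_invertible_ker[of ?A] invertible_left_inverse[of ?A]
    by blast
  also have "\<dots> \<longleftrightarrow> (\<exists>c. (\<exists>i<3. c i \<noteq> 0) \<and> (\<forall>k<3. (\<Sum>i<3. c i * m i k) = 0))"
  proof safe
    fix z assume z: "?A *v z = 0" "z \<noteq> 0"
    define c where "c i = (if i = 0 then vec_nth z 1 else if i = 1 then vec_nth z 2 else vec_nth z 3)" for i :: nat
    have "\<exists>i<3. c i \<noteq> 0"
      using z(2) by (auto simp: ex_less_3 c_def Finite_Cartesian_Product.vec_eq_iff forall_3)
    moreover have "\<forall>k<3. (\<Sum>i<3. c i * m i k) = 0"
      using z(1) by (simp add: matrix_vector_mult_def Finite_Cartesian_Product.vec_eq_iff forall_3 sum_3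
          c_def all_less_3 sum_less_3 mult.commute)
    ultimately show "\<exists>c. (\<exists>i<3. c i \<noteq> 0) \<and> (\<forall>k<3. (\<Sum>i<3. c i * m i k) = 0)" by blast
  next
    fix c i assume c: "i < (3::nat)" "c i \<noteq> 0" "\<forall>k<3. (\<Sum>i<3. c i * m i k) = 0"
    let ?z = "(\<chi> i. c (if i = 1 then 0 else if i = 2 then 1 else 2)) :: complex^3"
    have "\<exists>i<3. c i \<noteq> 0" using c by blast
    then have "?z \<noteq> 0"
      by (auto simp: ex_less_3 Finite_Cartesian_Product.vec_eq_iff forall_3)
    moreover have "?A *v ?z = 0"
      using c(3) by (simp add: matrix_vector_mult_def Finite_Cartesian_Product.vec_eq_iff forall_3 sum_3
          all_less_3 sum_less_3 mult.commute)
    ultimately show "\<exists>z. ?A *v z = 0 \<and> z \<noteq> 0" by blast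
  qed
  finally show ?thesis .
qed

lemma sum_less_2: "(\<Sum>i<2::nat. f i) = f 0 + f 1"
  for f :: "nat \<Rightarrow> 'a::comm_monoid_add"
  by (simp add: numeral_2_eq_2)

lemma row_flag_2: "row_flag n g 2 = span2 (trunc_row n g 0) (trunc_row n g 1)"
proof -
  have *: "(\<Sum>r<2. cscale (c r) (trunc_row n g r)) = cscale (c 0) (trunc_row n g 0) + cscale (c 1) (trunc_row n g 1)" for c
    by (rule sum_less_2)
  show ?thesis unfolding row_flag_def cspan_lessThan span2_def *
  proof (intro Collect_cong iffI)
    fix z assume "\<exists>a b. z = cscale a (trunc_row n g 0) + cscale b (trunc_row n g 1)"
    then obtain a b where z: "z = cscale a (trunc_row n g 0) + cscale b (trunc_row n g 1)" by auto
    define c where "c i = (if i = 0 then a else b)" for i :: nat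
    have "c 0 = a" "c 1 = b" by (simp_all add: c_def)
    then have "z = cscale (c 0) (trunc_row n g 0) + cscale (c 1) (trunc_row n g 1)"
      by (simp only: z)
    then show "\<exists>c::nat \<Rightarrow> complex. z = cscale (c 0) (trunc_row n g 0) + cscale (c 1) (trunc_row n g 1) \<and> True"
      by (intro exI[of _ c] conjI TrueI)
  qed auto
qed

lemma span2_change_basis:
  assumes "a * d - b * c \<noteq> 0"
  shows "span2 (cscale a v + cscale b w) (cscale c v + cscale d w) = span2 v w"
proof (intro equalityI subsetI)
  fix z assume "z \<in> span2 (cscale a v + cscale b w) (cscale c v + cscale d w)"
  then obtain s t where "z = cscale s (cscale a v + cscale b w) + cscale t (cscale c v + cscale d w)"
    by (auto simp: span2_def)
  then have "z = cscale (s * a + t * c) v + cscale (s * b + t * d) w"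
    by (auto simp: fun_eq_iff cscale_apply algebra_simps)
  then show "z \<in> span2 v w" unfolding span2_def by auto
next
  fix z assume "z \<in> span2 v w"
  then obtain s t where z: "z = cscale s v + cscale t w" by (auto simp: span2_def)
  define e where "e = a * d - b * c"
  have e: "e \<noteq> 0" using assms by (simp add: e_def)
  have ez: "e * z i = (s * d - t * c) * (a * v i + b * w i) + (t * a - s * b) * (c * v i + d * w i)" for i
    by (simp add: z e_def cscale_apply algebra_simps)
  have "z i = (s * d - t * c) / e * (a * v i + b * w i) + (t * a - s * b) / e * (c * v i + d * w i)" for i
  proof -
    have "z i = (e * z i) / e" using e by simp
    then show ?thesis by (simp only: ez add_divide_distrib times_divide_eq_left)
  qed
  then have "z = cscale ((s * d - t * c) / e) (cscale a v + cscale b w) + cscale ((t * a - s * b) / e) (cscale c v + cscale d w)"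
    by (simp add: fun_eq_iff cscale_apply)
  then show "z \<in> span2 (cscale a v + cscale b w) (cscale c v + cscale d w)"
    unfolding span2_def by blast
qed

lemma lin_indep_comb_nonzero:
  assumes "lin_indep n f" "i < n" "c i \<noteq> 0"
  shows "(\<Sum>r<n. cscale (c r) (f r)) \<noteq> 0"
  using assms unfolding lin_indep_def by blast

lemma pencil_in_Cn:
  "x i \<in> Cn n \<Longrightarrow> y i \<in> Cn n \<Longrightarrow> pencil x y u v i \<in> Cn n"
  by (simp add: pencil_def Cn_def cscale_apply)

lemma span_pencil_in_grass:
  assumes ind: "pair_indep p x y" and uv: "u \<noteq> 0 \<or> v \<noteq> 0"
    and xy: "\<And>i. i < p \<Longrightarrow> x i \<in> Cn n" "\<And>i. i < p \<Longrightarrow> y i \<in> Cn n"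
  shows "cspan (pencil x y u v ` {..<p}) \<in> grass p n"
proof -
  have "cspan (pencil x y u v ` {..<p}) \<subseteq> Cn n"
    by (rule cv.span_minimal[OF _ csubspace_Cn]) (use xy in \<open>auto intro!: pencil_in_Cn\<close>)
  then show ?thesis
    using cdim_span_lin_indep[OF lin_indep_pencil[OF ind uv]] by (simp add: grass_def)
qed

text \<open>The 3-space is cut out by the coordinates 3, 4, 5, hence \<open>k + 3\<close>. A
  combination of the pencil vectors lies in it iff its coefficients form a row relation of the
  matrix of these coordinates.\<close>

lemma span_pencil_meets_row_flag:
  assumes ind: "pair_indep 3 x y" and uv: "u \<noteq> 0 \<or> v \<noteq> 0"
    and xy: "\<And>i. i < 3 \<Longrightarrow> x i \<in> Cn 6" "\<And>i. i < 3 \<Longrightarrow> y i \<in> Cn 6"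
    and g: "nmat_det 6 g \<noteq> 0"
  shows "(\<exists>w \<in> cspan (pencil x y u v ` {..<3}) \<inter> row_flag 6 g 3. w \<noteq> 0) \<longleftrightarrow>
    det3 (\<lambda>i k. u * row_coord 6 g (k + 3) (x i) + v * row_coord 6 g (k + 3) (y i)) = 0"
proof -
  have flag: "w \<in> row_flag 6 g 3 \<longleftrightarrow> (\<forall>k<3. row_coord 6 g (k + 3) w = 0)" if "w \<in> Cn 6" for w
  proof -
    have "(\<forall>k. 3 \<le> k \<and> k < 6 \<longrightarrow> row_coord 6 g k w = 0) \<longleftrightarrow> (\<forall>k<3. row_coord 6 g (k + 3) w = 0)"
    proof safe
      fix k :: nat assume "\<forall>k<3. row_coord 6 g (k + 3) w = 0" "3 \<le> k" "k < 6"
      moreover from this have "k - 3 < 3" by simp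
      ultimately have "row_coord 6 g (k - 3 + 3) w = 0" by blast
      then show "row_coord 6 g k w = 0" using \<open>3 \<le> k\<close> by simp
    qed auto
    then show ?thesis using that by (simp add: row_flag_eq_coords[OF g])
  qed
  have coord: "row_coord 6 g k (\<Sum>i<3. cscale (c i) (pencil x y u v i)) =
      (\<Sum>i<3. c i * (u * row_coord 6 g k (x i) + v * row_coord 6 g k (y i)))" for k c
    by (simp add: row_coord_sum row_coord_scale row_coord_add pencil_def)
  have Cn: "(\<Sum>i<3. cscale (c i) (pencil x y u v i)) \<in> Cn 6" for c
    by (rule cv.subspace_sum[OF csubspace_Cn] cv.subspace_scale[OF csubspace_Cn] pencil_in_Cn xy | simp)+
  have nz: "(\<Sum>i<3. cscale (c i) (pencil x y u v i)) \<noteq> 0 \<longleftrightarrow> (\<exists>i<3. c i \<noteq> 0)" for c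
    using lin_indep_comb_nonzero[OF lin_indep_pencil[OF ind uv]] by (auto intro!: sum.neutral)
  have "(\<exists>w \<in> cspan (pencil x y u v ` {..<3}) \<inter> row_flag 6 g 3. w \<noteq> 0) \<longleftrightarrow>
    (\<exists>c. (\<Sum>i<3. cscale (c i) (pencil x y u v i)) \<in> row_flag 6 g 3 \<and> (\<Sum>i<3. cscale (c i) (pencil x y u v i)) \<noteq> 0)"
    unfolding cspan_lessThan by auto
  then show ?thesis unfolding det3_eq_0_iff flag[OF Cn] coord nz by (simp only: conj_commute)
qed

section \<open>The Schubert intersection as the zero set of a cubic\<close>

definition four_lines_and_plane :: "nat list list" where
  "four_lines_and_plane = [pieri 3 2, pieri 3 2, pieri 3 2, pieri 3 2, pieri 3 1]"

lemma schubert_inter_iff: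
  assumes "\<And>j. j < 5 \<Longrightarrow> nmat_det 6 (gs j) \<noteq> 0"
  shows "X \<in> schubert_inter 3 6 four_lines_and_plane (\<lambda>j. row_flag 6 (gs j)) \<longleftrightarrow>
    X \<in> grass 3 6 \<and> (\<forall>j<4. \<exists>w \<in> X \<inter> row_flag 6 (gs j) 2. w \<noteq> 0) \<and> (\<exists>w \<in> X \<inter> row_flag 6 (gs 4) 3. w \<noteq> 0)"
proof (cases "X \<in> grass 3 6")
  case True
  then have iff: "X \<in> schubert_var 3 6 (pieri 3 a) (row_flag 6 (gs j)) \<longleftrightarrow> (\<exists>w \<in> X \<inter> row_flag 6 (gs j) (4 - a). w \<noteq> 0)"
    if "a \<le> 3" "j < 5" for a j
    using schubert_var_pieri_iff[of 3 3 "gs j" X a] that assms[of j] by simp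
  have all5: "(\<forall>j<5::nat. P j) \<longleftrightarrow> (\<forall>j<4. P j) \<and> P 4" for P
    by (auto simp: less_Suc_eq eval_nat_numeral)
  have "four_lines_and_plane ! j = pieri 3 2" if "j < 4" for j
    using that by (auto simp: less_Suc_eq eval_nat_numeral four_lines_and_plane_def)
  moreover have "four_lines_and_plane ! 4 = pieri 3 1" "length four_lines_and_plane = 5"
    by (simp_all add: four_lines_and_plane_def)
  ultimately have "X \<in> schubert_inter 3 6 four_lines_and_plane (\<lambda>j. row_flag 6 (gs j)) \<longleftrightarrow>
    (\<forall>j<4. X \<in> schubert_var 3 6 (pieri 3 2) (row_flag 6 (gs j))) \<and> X \<in> schubert_var 3 6 (pieri 3 1) (row_flag 6 (gs 4))"
    using True all5[of "\<lambda>j. X \<in> schubert_var 3 6 (four_lines_and_plane ! j) (row_flag 6 (gs j))"]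
    by (simp add: schubert_inter_def lessThan_def)
  then show ?thesis using True iff[of 2] iff[of 1 4] by simp
qed (simp add: schubert_inter_def)

text \<open>Common to osculating and generic flags. The determinant in \<open>lead\<close> is the
  coefficient of \<open>v ^ 3\<close>, equally the value of the homogeneous cubic at
  \<open>u = 0\<close>, \<open>v = 1\<close>; as it is nonzero, every solution can be normalised to
  \<open>u = 1\<close>.\<close>

lemma schubert_inter_pencil:
  assumes ind: "pair_indep 3 x y"
    and xy: "\<And>i. i < 3 \<Longrightarrow> x i \<in> Cn 6" "\<And>i. i < 3 \<Longrightarrow> y i \<in> Cn 6"
    and g: "\<And>j. j < 5 \<Longrightarrow> nmat_det 6 (gs j) \<noteq> 0"
    and L: "\<And>i. i < 3 \<Longrightarrow> row_flag 6 (gs i) 2 = span2 (x i) (y i)"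
    and L3: "row_flag 6 (gs 3) 2 = span2 (\<Sum>i<3. x i) (\<Sum>i<3. y i)"
    and lead: "det3 (\<lambda>i k. row_coord 6 (gs 4) (k + 3) (y i)) \<noteq> 0"
  shows "schubert_inter 3 6 four_lines_and_plane (\<lambda>j. row_flag 6 (gs j)) =
    (\<lambda>v. cspan (pencil x y 1 v ` {..<3})) `
      {v. det3 (\<lambda>i k. row_coord 6 (gs 4) (k + 3) (x i) + v * row_coord 6 (gs 4) (k + 3) (y i)) = 0}"
    (is "?S = ?Z ` ?R")
proof (intro equalityI subsetI)
  have g4: "nmat_det 6 (gs 4) \<noteq> 0" by (rule g) simp
  have less4: "(\<forall>j<4::nat. P j) \<longleftrightarrow> (\<forall>j<3. P j) \<and> P 3" for P
    by (auto simp: less_Suc_eq eval_nat_numeral)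
  {
    fix X assume "X \<in> ?S"
    then have X: "csubspace X" "cdim X = 3" "\<And>j. j < 3 \<Longrightarrow> \<exists>w \<in> X \<inter> span2 (x j) (y j). w \<noteq> 0"
       "\<exists>w \<in> X \<inter> span2 (\<Sum>i<3. x i) (\<Sum>i<3. y i). w \<noteq> 0"
       "\<exists>w \<in> X \<inter> row_flag 6 (gs 4) 3. w \<noteq> 0"
      using L L3 by (auto simp: schubert_inter_iff[OF g] less4 grass_def)
    obtain u v where uv: "u \<noteq> 0 \<or> v \<noteq> 0" and Xuv: "X = cspan (pencil x y u v ` {..<3})"
      using span_pencil_cases[OF ind _ X(1-4)] by auto
    have d: "det3 (\<lambda>i k. u * row_coord 6 (gs 4) (k + 3) (x i) + v * row_coord 6 (gs 4) (k + 3) (y i)) = 0"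
      using span_pencil_meets_row_flag[OF ind uv xy g4] X(5) Xuv by simp
    have u: "u \<noteq> 0"
    proof
      assume "u = 0"
      then have "v ^ 3 * det3 (\<lambda>i k. row_coord 6 (gs 4) (k + 3) (y i)) = 0"
        using d by (simp add: det3_def algebra_simps power3_eq_cube)
      then show False using lead uv \<open>u = 0\<close> by simp
    qed
    have "pencil x y u v i = cscale u (pencil x y 1 (v / u) i)" for i
      using u by (simp add: pencil_def cv.scale_right_distrib)
    then have "pencil x y 1 (v / u) i = cscale (1 / u) (pencil x y u v i)" for i
      using u by simp
    then have "pencil x y 1 (v / u) i \<in> X" if "i < 3" for i
      using that X(1) Xuv by (auto intro!: cv.subspace_scale intro: cv.span_base)
    then have XZ: "X = ?Z (v / u)"
      using lin_indep_spans[OF X(1,2) _ lin_indep_pencil[OF ind, of 1 "v / u"]] by simp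
    then have "v / u \<in> ?R"
      using span_pencil_meets_row_flag[OF ind _ xy g4, of 1 "v / u"] X(5) by simp
    with XZ show "X \<in> ?Z ` ?R" by blast
  next
    fix X assume "X \<in> ?Z ` ?R"
    then obtain v where v: "X = ?Z v" "v \<in> ?R" by blast
    have 1: "X \<in> grass 3 6" unfolding v(1) by (rule span_pencil_in_grass[OF ind _ xy]) auto
    have nz: "pencil x y 1 v i \<noteq> 0" if "i < 3" for i
    proof
      assume "pencil x y 1 v i = 0"
      then have "(\<Sum>r<3. cscale (if r = i then 1 else 0) (pencil x y 1 v r)) = 0"
        by (intro sum.neutral) auto
      then show False
        using lin_indep_comb_nonzero[OF lin_indep_pencil[OF ind, of 1 v] that, of "\<lambda>r. if r = i then 1 else 0"] by simp
    qed
    have 2: "\<exists>w \<in> X \<inter> row_flag 6 (gs j) 2. w \<noteq> 0" if "j < 3" for j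
    proof (intro bexI[of _ "pencil x y 1 v j"] IntI)
      show "pencil x y 1 v j \<in> X" using that v(1) by (auto intro: cv.span_base)
      show "pencil x y 1 v j \<in> row_flag 6 (gs j) 2"
        unfolding L[OF that] span2_def pencil_def by blast
    qed (rule nz[OF that])
    have 3: "\<exists>w \<in> X \<inter> row_flag 6 (gs 3) 2. w \<noteq> 0"
    proof (intro bexI[of _ "\<Sum>i<3. pencil x y 1 v i"] IntI)
      show "(\<Sum>i<3. pencil x y 1 v i) \<in> X" unfolding v(1)
        by (intro cv.span_sum cv.span_base) auto
      show "(\<Sum>i<3. pencil x y 1 v i) \<in> row_flag 6 (gs 3) 2"
        unfolding L3 span2_def sum_pencil by blast
      show "(\<Sum>i<3. pencil x y 1 v i) \<noteq> 0"
        using lin_indep_comb_nonzero[OF lin_indep_pencil[OF ind, of 1 v], of 0 "\<lambda>_. 1"] by simp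
    qed
    have 4: "\<exists>w \<in> X \<inter> row_flag 6 (gs 4) 3. w \<noteq> 0"
      using span_pencil_meets_row_flag[OF ind _ xy g4, of 1 v] v by simp
    show "X \<in> ?S" using 1 2 3 4 by (simp add: schubert_inter_iff[OF g] less4)
  }
qed

lemma card_schubert_inter_pencil:
  assumes "pair_indep 3 x y"
    and "\<And>i. i < 3 \<Longrightarrow> x i \<in> Cn 6" "\<And>i. i < 3 \<Longrightarrow> y i \<in> Cn 6"
    and "\<And>j. j < 5 \<Longrightarrow> nmat_det 6 (gs j) \<noteq> 0"
    and "\<And>i. i < 3 \<Longrightarrow> row_flag 6 (gs i) 2 = span2 (x i) (y i)"
    and "row_flag 6 (gs 3) 2 = span2 (\<Sum>i<3. x i) (\<Sum>i<3. y i)"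
    and "det3 (\<lambda>i k. row_coord 6 (gs 4) (k + 3) (y i)) \<noteq> 0"
    and R: "finite R" "card R = 3"
      "{v. det3 (\<lambda>i k. row_coord 6 (gs 4) (k + 3) (x i) + v * row_coord 6 (gs 4) (k + 3) (y i)) = 0} = R"
  shows "finite (schubert_inter 3 6 four_lines_and_plane (\<lambda>j. row_flag 6 (gs j)))"
    "card (schubert_inter 3 6 four_lines_and_plane (\<lambda>j. row_flag 6 (gs j))) = 3"
proof -
  have "inj_on (\<lambda>v. cspan (pencil x y 1 v ` {..<3})) R"
    by (rule inj_onI) (use inj_span_pencil[OF assms(1)] in auto)
  moreover have eq: "schubert_inter 3 6 four_lines_and_plane (\<lambda>j. row_flag 6 (gs j)) =
      (\<lambda>v. cspan (pencil x y 1 v ` {..<3})) ` R"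
    using schubert_inter_pencil[OF assms(1-7)] by (simp only: R(3))
  ultimately show "finite (schubert_inter 3 6 four_lines_and_plane (\<lambda>j. row_flag 6 (gs j)))"
    "card (schubert_inter 3 6 four_lines_and_plane (\<lambda>j. row_flag 6 (gs j))) = 3"
    using R by (simp_all add: eq card_image)
qed

section \<open>Osculating flags\<close>

definition osc_mat :: "complex \<Rightarrow> nat \<Rightarrow> nat \<Rightarrow> complex" where
  "osc_mat s = (\<lambda>i j. if i \<le> j then of_nat (j choose i) * s ^ (j - i) else 0)"

lemma osc_flag_eq: "osc_flag n s = row_flag n (osc_mat s)"
  by (simp add: osc_flag_def osc_mat_def)

lemma nmat_det_osc_mat [simp]: "nmat_det n (osc_mat s) = 1"
proof -
  let ?A = "Matrix.mat n n (\<lambda>(i, j). osc_mat s i j)"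
  have "upper_triangular ?A" by (auto simp: osc_mat_def)
  then have "Determinant.det ?A = prod_list (diag_mat ?A)"
    by (rule det_upper_triangular[where n = n]) simp
  also have "diag_mat ?A = replicate n 1"
    by (rule nth_equalityI) (auto simp: diag_mat_def osc_mat_def)
  finally show ?thesis by (simp add: nmat_det_def)
qed

abbreviation osc_pt :: "complex \<Rightarrow> nat \<Rightarrow> complex" where
  "osc_pt s \<equiv> trunc_row 6 (osc_mat s) 0"

abbreviation osc_tangent :: "complex \<Rightarrow> nat \<Rightarrow> complex" where
  "osc_tangent s \<equiv> trunc_row 6 (osc_mat s) 1"

text \<open>The binomial theorem for \<open>((s - t) + t) ^ j\<close>. Coordinates with respect to
  the flag at \<open>t\<close> thus depend on \<open>s - t\<close> only.\<close>

lemma osc_pt_expand: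
  "osc_pt s = (\<Sum>k<6. cscale ((s - t) ^ k) (trunc_row 6 (osc_mat t) k))"
proof
  fix j
  show "osc_pt s j = (\<Sum>k<6. cscale ((s - t) ^ k) (trunc_row 6 (osc_mat t) k)) j"
  proof (cases "j < 6")
    case True
    have "s ^ j = ((s - t) + t) ^ j" by simp
    also have "\<dots> = (\<Sum>k\<le>j. of_nat (j choose k) * (s - t) ^ k * t ^ (j - k))"
      by (rule binomial_ring)
    also have "\<dots> = (\<Sum>k\<le>j. (s - t) ^ k * osc_mat t k j)"
      by (intro sum.cong) (auto simp: osc_mat_def)
    also have "\<dots> = (\<Sum>k<6. (s - t) ^ k * osc_mat t k j)"
      using True by (intro sum.mono_neutral_left) (auto simp: osc_mat_def)
    finally show ?thesis using True by (simp add: sum_fun_eval cscale_apply osc_mat_def)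
  qed (simp add: sum_fun_eval cscale_apply)
qed

text \<open>The derivative of \<open>osc_pt_expand\<close> in \<open>s\<close>, verified through
  \<open>Suc k * (Suc j' choose Suc k) = Suc j' * (j' choose k)\<close>.\<close>

lemma osc_tangent_expand:
  "osc_tangent s = (\<Sum>k<6. cscale (of_nat k * (s - t) ^ (k - 1)) (trunc_row 6 (osc_mat t) k))"
proof
  fix j
  show "osc_tangent s j = (\<Sum>k<6. cscale (of_nat k * (s - t) ^ (k - 1)) (trunc_row 6 (osc_mat t) k)) j"
  proof (cases "j < 6")
    case True
    \<comment> \<open>The term \<open>k = 0\<close>, where \<open>k - 1\<close> is truncated,
      vanishes by its factor \<open>of_nat k\<close>.\<close>
    have "(\<Sum>k<6. of_nat k * (s - t) ^ (k - 1) * osc_mat t k j) = (\<Sum>k\<in>{..j} - {0}. of_nat k * (s - t) ^ (k - 1) * osc_mat t k j)"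
      using True by (intro sum.mono_neutral_right) (auto simp: osc_mat_def)
    also have "\<dots> = osc_mat s 1 j"
    proof (cases j)
      case 0
      then show ?thesis by (simp add: osc_mat_def)
    next
      case (Suc j')
      have "{..j} - {0} = Suc ` {..j'}" by (auto simp: Suc atMost_Suc_eq_insert_0)
      then have "(\<Sum>k\<in>{..j} - {0}. of_nat k * (s - t) ^ (k - 1) * osc_mat t k j) =
         (\<Sum>k\<le>j'. of_nat (Suc k) * (s - t) ^ k * osc_mat t (Suc k) j)"
        by (simp add: sum.reindex)
      also have "\<dots> = (\<Sum>k\<le>j'. of_nat (Suc j') * (of_nat (j' choose k) * (s - t) ^ k * t ^ (j' - k)))"
      proof (rule sum.cong)
        fix k assume "k \<in> {..j'}"
        then have "osc_mat t (Suc k) j = of_nat (Suc j' choose Suc k) * t ^ (j' - k)"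
          by (simp add: osc_mat_def Suc del: binomial_Suc_Suc)
        moreover have "of_nat (Suc k) * of_nat (Suc j' choose Suc k) = (of_nat (Suc j') * of_nat (j' choose k) :: complex)"
          unfolding of_nat_mult [symmetric] Suc_times_binomial_eq by (simp only: mult.commute)
        moreover have "x * z * (y * w) = u * (r * z * w)" if "x * y = u * r" for x y z w u r :: complex
        proof -
          have "x * z * (y * w) = x * y * (z * w)" by (simp add: mult_ac)
          then show ?thesis by (simp add: that mult_ac)
        qed
        ultimately show "of_nat (Suc k) * (s - t) ^ k * osc_mat t (Suc k) j =
            of_nat (Suc j') * (of_nat (j' choose k) * (s - t) ^ k * t ^ (j' - k))"
          by simp
      qed simp
      also have "\<dots> = of_nat (Suc j') * ((s - t) + t) ^ j'"
        unfolding binomial_ring by (simp add: sum_distrib_left)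
      also have "\<dots> = osc_mat s 1 j" by (simp add: osc_mat_def Suc)
      finally show ?thesis .
    qed
    finally show ?thesis using True by (simp add: sum_fun_eval cscale_apply)
  qed (simp add: sum_fun_eval cscale_apply)
qed

text \<open>With h = s - t the vector represents the functional sending a polynomial f to a f(h) + b
  f'(h); coordinate \<open>k\<close> is its value at z^k.\<close>

lemma row_coord_osc:
  assumes "k < 6"
  shows "row_coord 6 (osc_mat t) k (cscale a (osc_pt s) + cscale b (osc_tangent s)) =
    a * (s - t) ^ k + b * (of_nat k * (s - t) ^ (k - 1))"
  unfolding row_coord_add row_coord_scale osc_pt_expand[of s t] osc_tangent_expand[of s t]
  using assms by (simp add: row_coord_comb)

lemma zero_if_row_coords_zero:
  assumes "nmat_det n g \<noteq> 0" "w \<in> Cn n" "\<And>k. k < n \<Longrightarrow> row_coord n g k w = 0"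
  shows "w = 0"
  using row_expansion[OF assms(2), of g] assms(1,3) by simp

subsection \<open>Algebraic identities\<close>

text \<open>Relation \<open>k\<close> says that a combination of values and derivatives at the three
  nodes kills z^k. Applied to permuted nodes, this yields independence of the points and tangents at
  three distinct parameters.\<close>

lemma confluent_vandermonde3:
  fixes a b c :: complex
  assumes eq: "\<And>k. k < 6 \<Longrightarrow> A * a ^ k + A' * (of_nat k * a ^ (k - 1)) + (B * b ^ k + B' * (of_nat k * b ^ (k - 1)))
     + (C * c ^ k + C' * (of_nat k * c ^ (k - 1))) = 0"
    and ne: "a \<noteq> b" "a \<noteq> c"
  shows "A = 0 \<and> A' = 0"
proof -
  define e where "e k = A * a ^ k + A' * (of_nat k * a ^ (k - 1)) + (B * b ^ k + B' * (of_nat k * b ^ (k - 1)))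
     + (C * c ^ k + C' * (of_nat k * c ^ (k - 1)))" for k
  have e: "e 0 = 0" "e 1 = 0" "e 2 = 0" "e 3 = 0" "e 4 = 0" "e 5 = 0"
    unfolding e_def by (rule eq; simp)+
  have e': "e 0 = A + B + C" "e 1 = A * a + A' + (B * b + B') + (C * c + C')"
    "e 2 = A * a^2 + A' * (2 * a) + (B * b^2 + B' * (2 * b)) + (C * c^2 + C' * (2 * c))"
    "e 3 = A * a^3 + A' * (3 * a^2) + (B * b^3 + B' * (3 * b^2)) + (C * c^3 + C' * (3 * c^2))"
    "e 4 = A * a^4 + A' * (4 * a^3) + (B * b^4 + B' * (4 * b^3)) + (C * c^4 + C' * (4 * c^3))"
    "e 5 = A * a^5 + A' * (5 * a^4) + (B * b^5 + B' * (5 * b^4)) + (C * c^5 + C' * (5 * c^4))"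
    unfolding e_def by simp_all
  let ?u = "b + c" let ?w = "b * c"
  \<comment> \<open>Pair the relations with the coefficients of $(z-a)(z-b)^2(z-c)^2$ and $(z-b)^2(z-c)^2$.\<close>
  have "e 5 - (2 * ?u + a) * e 4 + (?u^2 + 2 * ?w + 2 * a * ?u) * e 3 - (2 * ?u * ?w + a * (?u^2 + 2 * ?w)) * e 2
     + (?w^2 + 2 * a * ?u * ?w) * e 1 - a * ?w^2 * e 0 = A' * (a - b)^2 * (a - c)^2"
    unfolding e' by (simp add: algebra_simps eval_nat_numeral)
  then have A': "A' = 0" using ne by (simp add: e del: One_nat_def)
  have "e 4 - 2 * ?u * e 3 + (?u^2 + 2 * ?w) * e 2 - 2 * ?u * ?w * e 1 + ?w^2 * e 0
    = A * (a - b)^2 * (a - c)^2 + A' * 2 * (a - b) * (a - c) * (2 * a - b - c)"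
    unfolding e' by Groebner_Basis.algebra
  then show ?thesis using ne A' by (simp add: e del: One_nat_def)
qed

text \<open>P'(h_i) for P = prod_j (z - h_j).\<close>

definition node_prod :: "(nat \<Rightarrow> complex) \<Rightarrow> nat \<Rightarrow> complex" where
  "node_prod h i = (\<Prod>j\<in>{..<4} - {i}. h i - h j)"

text \<open>P''(h_i) / 2 for the same P, that is, the derivative at h_i of P without its factor z -
  h_i.\<close>

definition node_prod' :: "(nat \<Rightarrow> complex) \<Rightarrow> nat \<Rightarrow> complex" where
  "node_prod' h i = (\<Sum>j\<in>{..<4} - {i}. \<Prod>k\<in>{..<4} - {i, j}. h i - h k)"

lemma lessThan_4: "{..<4::nat} = {0, 1, 2, 3}"
  by auto

lemma node_prod_simps:
  "node_prod h 0 = (h 0 - h 1) * (h 0 - h 2) * (h 0 - h 3)"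
  "node_prod h 1 = (h 1 - h 0) * (h 1 - h 2) * (h 1 - h 3)"
  "node_prod h 2 = (h 2 - h 0) * (h 2 - h 1) * (h 2 - h 3)"
  "node_prod h 3 = (h 3 - h 0) * (h 3 - h 1) * (h 3 - h 2)"
  by (simp_all add: node_prod_def lessThan_4 insert_Diff_if mult.assoc)

lemma node_prod'_simps:
  "node_prod' h 0 = (h 0 - h 2) * (h 0 - h 3) + (h 0 - h 1) * (h 0 - h 3) + (h 0 - h 1) * (h 0 - h 2)"
  "node_prod' h 1 = (h 1 - h 2) * (h 1 - h 3) + (h 1 - h 0) * (h 1 - h 3) + (h 1 - h 0) * (h 1 - h 2)"
  "node_prod' h 2 = (h 2 - h 1) * (h 2 - h 3) + (h 2 - h 0) * (h 2 - h 3) + (h 2 - h 0) * (h 2 - h 1)"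
  "node_prod' h 3 = (h 3 - h 1) * (h 3 - h 2) + (h 3 - h 0) * (h 3 - h 2) + (h 3 - h 0) * (h 3 - h 1)"
  by (simp_all add: node_prod'_def lessThan_4 insert_Diff_if add.assoc)

lemma node_prod_nonzero: "inj_on h {..<4} \<Longrightarrow> i < 4 \<Longrightarrow> node_prod h i \<noteq> 0"
  by (auto simp: node_prod_def inj_on_def)

text \<open>The residue theorem cleared of denominators by the cube of the product of all
  differences of nodes. The signs alternate because the differences are oriented. Each exponent is a
  separate polynomial identity.\<close>

lemma residue_sum_polynomial:
  fixes a b c d :: complex
  assumes "k \<le> 6"
  shows "(of_nat k * a ^ (k - 1) * ((a - b) * (a - c) * (a - d)) -
        2 * a ^ k * ((a - c) * (a - d) + (a - b) * (a - d) + (a - b) * (a - c))) * ((b - c) * (b - d) * (c - d)) ^ 3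
    - (of_nat k * b ^ (k - 1) * ((b - a) * (b - c) * (b - d)) -
        2 * b ^ k * ((b - c) * (b - d) + (b - a) * (b - d) + (b - a) * (b - c))) * ((a - c) * (a - d) * (c - d)) ^ 3
    + (of_nat k * c ^ (k - 1) * ((c - a) * (c - b) * (c - d)) -
        2 * c ^ k * ((c - b) * (c - d) + (c - a) * (c - d) + (c - a) * (c - b))) * ((a - b) * (a - d) * (b - d)) ^ 3
    - (of_nat k * d ^ (k - 1) * ((d - a) * (d - b) * (d - c)) -
        2 * d ^ k * ((d - b) * (d - c) + (d - a) * (d - c) + (d - a) * (d - b))) * ((a - b) * (a - c) * (b - c)) ^ 3 = 0"
    (is "?P k")
proof -
  have P: "?P 0" "?P 1" "?P 2" "?P 3" "?P 4" "?P 5" "?P 6"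
    by (simp, Groebner_Basis.algebra)+
  consider "k = 0" | "k = 1" | "k = 2" | "k = 3" | "k = 4" | "k = 5" | "k = 6"
    using assms by linarith
  then show ?thesis by cases (simp_all only: P)
qed

text \<open>The left-hand side is the sum of the residues of $z^k / \prod_i (z - h_i)^2$,
  whose residue at infinity vanishes because $k \<le> 6$.\<close>
lemma residue_sum:
  assumes h: "inj_on h {..<4}" and k: "k \<le> 6"
  shows "(\<Sum>i<4. (of_nat k * h i ^ (k - 1) * node_prod h i - 2 * h i ^ k * node_prod' h i) / node_prod h i ^ 3) = 0"
proof -
  let ?N = "\<lambda>i. of_nat k * h i ^ (k - 1) * node_prod h i - 2 * h i ^ k * node_prod' h i"
  define W where "W = (h 0 - h 1) * (h 0 - h 2) * (h 0 - h 3) * ((h 1 - h 2) * (h 1 - h 3) * (h 2 - h 3))"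
  have ne: "node_prod h i \<noteq> 0" if "i < 4" for i using that by (rule node_prod_nonzero[OF h])
  have W: "W = node_prod h 0 * ((h 1 - h 2) * (h 1 - h 3) * (h 2 - h 3))"
    "W = node_prod h 1 * - ((h 0 - h 2) * (h 0 - h 3) * (h 2 - h 3))"
    "W = node_prod h 2 * ((h 0 - h 1) * (h 0 - h 3) * (h 1 - h 3))"
    "W = node_prod h 3 * - ((h 0 - h 1) * (h 0 - h 2) * (h 1 - h 2))"
    unfolding W_def node_prod_simps by Groebner_Basis.algebra+
  have div: "x / D ^ 3 = x * M ^ 3 / W ^ 3" if "W = D * M" "D \<noteq> 0" "W \<noteq> 0" for x D M
    using that by (simp add: power_mult_distrib)
  have W0: "W \<noteq> 0"
    using h by (auto simp: W_def inj_on_def lessThan_4)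
  have "(\<Sum>i<4. ?N i / node_prod h i ^ 3) =
     ?N 0 / node_prod h 0 ^ 3 + ?N 1 / node_prod h 1 ^ 3 + ?N 2 / node_prod h 2 ^ 3 + ?N 3 / node_prod h 3 ^ 3"
    by (simp add: lessThan_4 add.assoc)
  also have "\<dots> = (?N 0 * ((h 1 - h 2) * (h 1 - h 3) * (h 2 - h 3)) ^ 3
     + ?N 1 * (- ((h 0 - h 2) * (h 0 - h 3) * (h 2 - h 3))) ^ 3
     + ?N 2 * ((h 0 - h 1) * (h 0 - h 3) * (h 1 - h 3)) ^ 3
     + ?N 3 * (- ((h 0 - h 1) * (h 0 - h 2) * (h 1 - h 2))) ^ 3) / W ^ 3"
    by (simp only: div[OF W(1) ne W0] div[OF W(2) ne W0] div[OF W(3) ne W0] div[OF W(4) ne W0]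
        add_divide_distrib)
  also have "\<dots> = 0"
    using residue_sum_polynomial[OF k, of "h 0" "h 1" "h 2" "h 3"]
    unfolding node_prod_simps node_prod'_simps by simp
  finally show ?thesis .
qed

lemma det3_scale_rows: "det3 (\<lambda>i k. r i * m i k) = r 0 * r 1 * r 2 * det3 m"
  by (simp add: det3_def algebra_simps)

text \<open>Row \<open>i\<close> holds the coordinates 3, 4, 5 of x_i + v y_i, freed of the factor
  \<open>h i ^ 2 / node_prod h i ^ 3\<close>. The last factor on the right is the derivative in
  \<open>v\<close> of prod (v h_i - 1).\<close>

lemma pencil_det_polynomial:
  fixes h :: "nat \<Rightarrow> complex" and v :: complex
  shows "det3 (\<lambda>i k. h i ^ k * ((of_nat k + 3) * (v * h i - 1) * node_prod h i
       + h i * (v * node_prod h i - 2 * (v * h i - 1) * node_prod' h i))) =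
    -6 * h 3 ^ 2 * ((h 0 - h 1) * (h 0 - h 2) * (h 1 - h 2)) ^ 3 *
     (h 0 * ((v * h 1 - 1) * (v * h 2 - 1) * (v * h 3 - 1)) + h 1 * ((v * h 0 - 1) * (v * h 2 - 1) * (v * h 3 - 1))
      + h 2 * ((v * h 0 - 1) * (v * h 1 - 1) * (v * h 3 - 1)) + h 3 * ((v * h 0 - 1) * (v * h 1 - 1) * (v * h 2 - 1)))"
proof -
  have c: "of_nat 0 + 3 = (3::complex)" "of_nat 1 + 3 = (4::complex)" "of_nat 2 + 3 = (5::complex)" by simp_all
  show ?thesis
    unfolding det3_def c node_prod_simps node_prod'_simps by Groebner_Basis.algebra
qed

text \<open>The coefficient of \<open>v ^ 3\<close> in \<open>pencil_det_polynomial\<close> after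
  one factor \<open>h i\<close> is taken out of each row. The constant is -6 times 4, since the
  derivative has leading coefficient 4 h_0 h_1 h_2 h_3.\<close>

lemma pencil_lead_det_polynomial:
  fixes h :: "nat \<Rightarrow> complex"
  shows "det3 (\<lambda>i k. h i ^ k * ((of_nat k + 4) * node_prod h i - 2 * h i * node_prod' h i)) =
    -24 * h 3 ^ 3 * ((h 0 - h 1) * (h 0 - h 2) * (h 1 - h 2)) ^ 3"
proof -
  have c: "of_nat 0 + 4 = (4::complex)" "of_nat 1 + 4 = (5::complex)" "of_nat 2 + 4 = (6::complex)" by simp_all
  show ?thesis
    unfolding det3_def c node_prod_simps node_prod'_simps by Groebner_Basis.algebra
qed

subsection \<open>Real zeros of the derivative\<close>

text \<open>Rolle's theorem, splitting off the largest zero. The clause \<open>v < Max A\<close>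
  makes the new critical point, which lies between the two largest zeros, different from all those
  found before.\<close>

lemma pderiv_roots_real:
  fixes p :: "real poly"
  assumes "finite A" "\<forall>a\<in>A. poly p a = 0" "card A = Suc n"
  shows "\<exists>R. finite R \<and> card R = n \<and> (\<forall>v\<in>R. poly (pderiv p) v = 0 \<and> v < Max A)"
  using assms
proof (induction n arbitrary: A)
  case 0
  show ?case by (rule exI[of _ "{}"]) simp
next
  case (Suc n)
  let ?B = "A - {Max A}"
  have "A \<noteq> {}" using Suc.prems by auto
  then have m: "Max A \<in> A" using Suc.prems(1) by simp
  then have B: "finite ?B" "\<forall>a\<in>?B. poly p a = 0" "card ?B = Suc n"
    using Suc.prems by auto
  then have "?B \<noteq> {}" by (metis Zero_not_Suc card.empty)
  then have mB: "Max ?B \<in> ?B" using B(1) by (rule Max_in[rotated])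
  then have lt: "Max ?B < Max A" using Max_ge[OF Suc.prems(1), of "Max ?B"] by auto
  obtain R where R: "finite R" "card R = n" "\<forall>v\<in>R. poly (pderiv p) v = 0 \<and> v < Max ?B"
    using Suc.IH[OF B] by blast
  obtain x where x: "Max ?B < x" "x < Max A" "poly p (Max A) - poly p (Max ?B) = (Max A - Max ?B) * poly (pderiv p) x"
    using poly_MVT[OF lt] by blast
  have "poly (pderiv p) x = 0" using x lt Suc.prems(2) m mB by auto
  moreover have "x \<notin> R" using R(3) x(1) by force
  ultimately show ?case using R x lt by (intro exI[of _ "insert x R"]) force
qed

lemma cubic_zero_set:
  fixes c0 c1 c2 c3 :: complex
  assumes "c3 \<noteq> 0" "finite R" "card R = 3" "\<forall>v\<in>R. c0 + c1 * v + c2 * v^2 + c3 * v^3 = 0"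
  shows "{v. c0 + c1 * v + c2 * v^2 + c3 * v^3 = 0} = R"
proof -
  let ?p = "[:c0, c1, c2, c3:]"
  have eq: "poly ?p v = c0 + c1 * v + c2 * v^2 + c3 * v^3" for v
    by (simp add: algebra_simps power2_eq_square power3_eq_cube)
  have ne: "?p \<noteq> 0" and deg: "degree ?p = 3" using assms(1) by simp_all
  have "finite {v. poly ?p v = 0}" by (rule poly_roots_finite[OF ne])
  moreover have "card {v. poly ?p v = 0} \<le> 3"
    using card_poly_roots_bound[OF ne] deg by simp
  moreover have "R \<subseteq> {v. poly ?p v = 0}" unfolding eq using assms(4) by blast
  ultimately have "R = {v. poly ?p v = 0}" using assms(3) by (intro card_seteq) auto
  then show ?thesis by (simp only: eq)
qed

text \<open>The polynomial prod (v h_i - 1) has the four distinct real zeros \<open>1 / h i\<close>,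
  so its derivative has three real zeros. As no \<open>h i\<close> is zero, the derivative has
  degree 3 and hence no further complex zeros.\<close>

lemma reciprocal_quartic_critical_points:
  fixes h :: "nat \<Rightarrow> real"
  assumes inj: "inj_on h {..<4}" and nz: "\<And>i. i < 4 \<Longrightarrow> h i \<noteq> 0"
  obtains R where "finite R" "card R = 3"
    "{v::complex. h 0 * ((v * h 1 - 1) * (v * h 2 - 1) * (v * h 3 - 1)) + h 1 * ((v * h 0 - 1) * (v * h 2 - 1) * (v * h 3 - 1))
      + h 2 * ((v * h 0 - 1) * (v * h 1 - 1) * (v * h 3 - 1)) + h 3 * ((v * h 0 - 1) * (v * h 1 - 1) * (v * h 2 - 1)) = 0}
      = complex_of_real ` R"
proof -
  define p where "p = [:-1, h 0:] * [:-1, h 1:] * [:-1, h 2:] * [:-1, h 3:]"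
  let ?q = "\<lambda>v. h 0 * ((v * h 1 - 1) * (v * h 2 - 1) * (v * h 3 - 1)) + h 1 * ((v * h 0 - 1) * (v * h 2 - 1) * (v * h 3 - 1))
      + h 2 * ((v * h 0 - 1) * (v * h 1 - 1) * (v * h 3 - 1)) + h 3 * ((v * h 0 - 1) * (v * h 1 - 1) * (v * h 2 - 1))"
  have pd: "poly (pderiv p) v = ?q v" for v
    unfolding p_def by (simp add: pderiv_mult pderiv_pCons algebra_simps)
  have "inj_on (\<lambda>i. 1 / h i) {..<4}"
    using inj nz by (auto simp: inj_on_def field_simps)
  then have "card ((\<lambda>i. 1 / h i) ` {..<4}) = Suc 3" by (simp add: card_image)
  moreover have "\<forall>a\<in>(\<lambda>i. 1 / h i) ` {..<4}. poly p a = 0"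
  proof safe
    fix i :: nat assume i: "i < 4"
    have pv: "poly p v = (v * h 0 - 1) * (v * h 1 - 1) * (v * h 2 - 1) * (v * h 3 - 1)" for v
      unfolding p_def poly_mult by simp
    have "1 / h i * h i - 1 = 0" using nz[OF i] by simp
    moreover from i have "i = 0 \<or> i = 1 \<or> i = 2 \<or> i = 3" by linarith
    ultimately show "poly p (1 / h i) = 0"
      unfolding pv by (elim disjE) simp_all
  qed
  ultimately obtain R where R: "finite R" "card R = 3" "\<forall>v\<in>R. ?q v = 0"
    using pderiv_roots_real[of "(\<lambda>i. 1 / h i) ` {..<4}" p 3] unfolding pd by auto
  \<comment> \<open>The elementary symmetric polynomials, which give the coefficients of the
    derivative.\<close>
  define e1 e2 e3 e4 where "e1 = h 0 + h 1 + h 2 + h 3"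
    and "e2 = h 0 * h 1 + h 0 * h 2 + h 0 * h 3 + h 1 * h 2 + h 1 * h 3 + h 2 * h 3"
    and "e3 = h 0 * h 1 * h 2 + h 0 * h 1 * h 3 + h 0 * h 2 * h 3 + h 1 * h 2 * h 3"
    and "e4 = h 0 * h 1 * h 2 * h 3"
  note e = e1_def e2_def e3_def e4_def
  have q: "?q v = (- e1) + (2 * e2) * v + (- 3 * e3) * v^2 + (4 * e4) * v^3" for v
    unfolding e by Groebner_Basis.algebra
  have qc: "h 0 * ((v * h 1 - 1) * (v * h 2 - 1) * (v * h 3 - 1)) + h 1 * ((v * h 0 - 1) * (v * h 2 - 1) * (v * h 3 - 1))
      + h 2 * ((v * h 0 - 1) * (v * h 1 - 1) * (v * h 3 - 1)) + h 3 * ((v * h 0 - 1) * (v * h 1 - 1) * (v * h 2 - 1)) =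
    of_real (- e1) + of_real (2 * e2) * v + of_real (- 3 * e3) * v^2 + of_real (4 * e4) * v^3" for v :: complex
    unfolding e of_real_add of_real_minus of_real_mult of_real_numeral by Groebner_Basis.algebra
  have "{v::complex. of_real (- e1) + of_real (2 * e2) * v + of_real (- 3 * e3) * v^2 + of_real (4 * e4) * v^3 = 0}
     = complex_of_real ` R"
  proof (rule cubic_zero_set)
    show "complex_of_real (4 * e4) \<noteq> 0" using nz by (simp add: e4_def)
    show "card (complex_of_real ` R) = 3" using R by (simp add: card_image inj_on_def)
    show "\<forall>v\<in>complex_of_real ` R. of_real (- e1) + of_real (2 * e2) * v + of_real (- 3 * e3) * v^2 + of_real (4 * e4) * v^3 = 0"
    proof safe
      fix v assume "v \<in> R"
      then have "(- e1) + (2 * e2) * v + (- 3 * e3) * v^2 + (4 * e4) * v^3 = 0" using R(3) q by simp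
      then have "complex_of_real ((- e1) + (2 * e2) * v + (- 3 * e3) * v^2 + (4 * e4) * v^3) = 0" by (simp only: of_real_0)
      then show "of_real (- e1) + of_real (2 * e2) * complex_of_real v + of_real (- 3 * e3) * complex_of_real v^2
          + of_real (4 * e4) * complex_of_real v^3 = 0"
        by (simp only: of_real_add of_real_mult of_real_power)
    qed
  qed (use R in simp)
  then show ?thesis using that R by (simp only: qc)
qed

subsection \<open>Counting for osculating flags\<close>

text \<open>The functionals $f \<mapsto> \mathrm{Res}_{h_i}\, q f / \prod_j (z - h_j)^2$ for $q = -1$ and
  for $q = z$, where the point and the tangent at $s_i$ stand for $f(h_i)$ and $f'(h_i)$.\<close>
definition res_const :: "(nat \<Rightarrow> complex) \<Rightarrow> (nat \<Rightarrow> complex) \<Rightarrow> nat \<Rightarrow> nat \<Rightarrow> complex" where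
  "res_const s h i = cscale (2 * node_prod' h i / node_prod h i ^ 3) (osc_pt (s i))
     + cscale (- node_prod h i / node_prod h i ^ 3) (osc_tangent (s i))"

definition res_lin :: "(nat \<Rightarrow> complex) \<Rightarrow> (nat \<Rightarrow> complex) \<Rightarrow> nat \<Rightarrow> nat \<Rightarrow> complex" where
  "res_lin s h i = cscale ((node_prod h i - 2 * h i * node_prod' h i) / node_prod h i ^ 3) (osc_pt (s i))
     + cscale (h i * node_prod h i / node_prod h i ^ 3) (osc_tangent (s i))"

locale osculating_lines =
  fixes s h :: "nat \<Rightarrow> complex" and t :: complex
  assumes h: "\<And>i. h i = s i - t" and inj: "inj_on h {..<4}" and nz: "\<And>i. i < 4 \<Longrightarrow> h i \<noteq> 0"
begin

lemma node_prod_nz: "i < 4 \<Longrightarrow> node_prod h i \<noteq> 0"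
  by (rule node_prod_nonzero[OF inj])

lemma row_coord_res_const:
  assumes "k < 6"
  shows "row_coord 6 (osc_mat t) k (res_const s h i) =
    - ((of_nat k * h i ^ (k - 1) * node_prod h i - 2 * h i ^ k * node_prod' h i) / node_prod h i ^ 3)"
  unfolding res_const_def row_coord_osc[OF assms] h [symmetric]
  by (simp add: diff_divide_distrib mult_ac)

text \<open>The factor q = z turns the test function z^k into z^(k+1). With \<open>k < 6\<close>
  this is why \<open>residue_sum\<close> has to reach exponent 6.\<close>

lemma row_coord_res_lin:
  assumes "k < 6"
  shows "row_coord 6 (osc_mat t) k (res_lin s h i) =
    (of_nat (Suc k) * h i ^ (Suc k - 1) * node_prod h i - 2 * h i ^ Suc k * node_prod' h i) / node_prod h i ^ 3"
proof -
  have e: "h i * (of_nat k * h i ^ (k - 1)) = of_nat k * h i ^ k"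
    by (cases k) simp_all
  have "row_coord 6 (osc_mat t) k (res_lin s h i) =
     ((node_prod h i - 2 * h i * node_prod' h i) * h i ^ k + node_prod h i * (h i * (of_nat k * h i ^ (k - 1)))) / node_prod h i ^ 3"
    unfolding res_lin_def row_coord_osc[OF assms] h [symmetric] add_divide_distrib
    by (simp only: times_divide_eq_left times_divide_eq_right mult_ac)
  then show ?thesis unfolding e by (simp add: algebra_simps)
qed

lemma res_in_Cn: "res_const s h i \<in> Cn 6" "res_lin s h i \<in> Cn 6"
  by (simp_all add: res_const_def res_lin_def Cn_def cscale_apply)

lemma sum_res_const: "(\<Sum>i<4. res_const s h i) = 0"
proof (rule zero_if_row_coords_zero[of 6 "osc_mat t"])
  fix k :: nat assume k: "k < 6"
  then show "row_coord 6 (osc_mat t) k (\<Sum>i<4. res_const s h i) = 0"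
    unfolding row_coord_sum row_coord_res_const[OF k] sum_negf using residue_sum[OF inj, of k] by simp
qed (auto intro: cv.subspace_sum[OF csubspace_Cn] res_in_Cn)

lemma sum_res_lin: "(\<Sum>i<4. res_lin s h i) = 0"
proof (rule zero_if_row_coords_zero[of 6 "osc_mat t"])
  fix k :: nat assume k: "k < 6"
  then show "row_coord 6 (osc_mat t) k (\<Sum>i<4. res_lin s h i) = 0"
    unfolding row_coord_sum row_coord_res_lin[OF k] using residue_sum[OF inj, of "Suc k"] by simp
qed (auto intro: cv.subspace_sum[OF csubspace_Cn] res_in_Cn)

lemma res_matrix_det:
  assumes "i < 4"
  shows "(2 * node_prod' h i / node_prod h i ^ 3) * (h i * node_prod h i / node_prod h i ^ 3) -
    (- node_prod h i / node_prod h i ^ 3) * ((node_prod h i - 2 * h i * node_prod' h i) / node_prod h i ^ 3) \<noteq> 0"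
proof -
  have id: "(2 * E / D3) * (x * D / D3) - (- D / D3) * ((D - 2 * x * E) / D3) = (D / D3)^2" for D E D3 x :: complex
    by (simp add: add_divide_distrib diff_divide_distrib algebra_simps power2_eq_square)
  show ?thesis unfolding id using node_prod_nz[OF assms] by simp
qed

lemma osc_flag_line:
  assumes "i < 4"
  shows "row_flag 6 (osc_mat (s i)) 2 = span2 (res_const s h i) (res_lin s h i)"
  unfolding row_flag_2 res_const_def res_lin_def
  by (rule span2_change_basis[symmetric]) (rule res_matrix_det[OF assms])

text \<open>For both choices of q the four residues sum to zero, so the sums over the first three
  nodes are the negatives of the vectors at the fourth.\<close>

lemma osc_flag_last_line:
  "row_flag 6 (osc_mat (s 3)) 2 = span2 (\<Sum>i<3. res_const s h i) (\<Sum>i<3. res_lin s h i)"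
proof -
  have four: "(\<Sum>i<4. f i) = (\<Sum>i<3. f i) + f 3" for f :: "nat \<Rightarrow> nat \<Rightarrow> complex"
    by (simp add: eval_nat_numeral)
  have "(\<Sum>i<3. res_const s h i) = - res_const s h 3" "(\<Sum>i<3. res_lin s h i) = - res_lin s h 3"
    using sum_res_const sum_res_lin unfolding four by (simp_all add: eq_neg_iff_add_eq_0)
  then have "span2 (\<Sum>i<3. res_const s h i) (\<Sum>i<3. res_lin s h i) =
    span2 (cscale (-1) (res_const s h 3) + cscale 0 (res_lin s h 3)) (cscale 0 (res_const s h 3) + cscale (-1) (res_lin s h 3))"
    by simp
  also have "\<dots> = span2 (res_const s h 3) (res_lin s h 3)"
    by (rule span2_change_basis) simp
  finally show ?thesis using osc_flag_line[of 3] by simp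
qed

lemma pair_indep_res: "pair_indep 3 (res_const s h) (res_lin s h)"
  unfolding pair_indep_def
proof (intro allI impI)
  fix a b i assume z: "(\<Sum>i<3. cscale (a i) (res_const s h i) + cscale (b i) (res_lin s h i)) = 0" and i: "i < (3::nat)"
  \<comment> \<open>\<open>A\<close> and \<open>A'\<close> are the coefficients of the same relation
    with respect to the points and tangents, to which \<open>confluent_vandermonde3\<close>
    applies.\<close>
  define A where "A i = a i * (2 * node_prod' h i / node_prod h i ^ 3) + b i * ((node_prod h i - 2 * h i * node_prod' h i) / node_prod h i ^ 3)" for i
  define A' where "A' i = a i * (- node_prod h i / node_prod h i ^ 3) + b i * (h i * node_prod h i / node_prod h i ^ 3)" for i
  have "cscale (a i) (res_const s h i) + cscale (b i) (res_lin s h i) = cscale (A i) (osc_pt (s i)) + cscale (A' i) (osc_tangent (s i))" for i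
    unfolding A_def A'_def res_const_def res_lin_def comb_pairs cv.scale_left_distrib by (simp only: add_ac)
  then have z': "(\<Sum>i<3. cscale (A i) (osc_pt (s i)) + cscale (A' i) (osc_tangent (s i))) = 0"
    using z by simp
  have eq: "(\<Sum>i<3. A i * h i ^ k + A' i * (of_nat k * h i ^ (k - 1))) = 0" if "k < 6" for k
  proof -
    have "row_coord 6 (osc_mat t) k (\<Sum>i<3. cscale (A i) (osc_pt (s i)) + cscale (A' i) (osc_tangent (s i))) = 0"
      unfolding z' by (simp add: row_coord_def)
    then show ?thesis unfolding row_coord_sum row_coord_osc[OF that] h [symmetric] .
  qed
  have ne: "h 0 \<noteq> h 1" "h 0 \<noteq> h 2" "h 1 \<noteq> h 2" using inj by (auto simp: inj_on_def lessThan_4)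
  have "A 0 = 0 \<and> A' 0 = 0"
    by (rule confluent_vandermonde3[of "A 0" "h 0" "A' 0" "A 1" "h 1" "A' 1" "A 2" "h 2" "A' 2"])
      (use eq ne in \<open>auto simp: sum_less_3 add_ac\<close>)
  moreover have "A 1 = 0 \<and> A' 1 = 0"
    by (rule confluent_vandermonde3[of "A 1" "h 1" "A' 1" "A 0" "h 0" "A' 0" "A 2" "h 2" "A' 2"])
      (use eq ne in \<open>auto simp: sum_less_3 add_ac\<close>)
  moreover have "A 2 = 0 \<and> A' 2 = 0"
    by (rule confluent_vandermonde3[of "A 2" "h 2" "A' 2" "A 1" "h 1" "A' 1" "A 0" "h 0" "A' 0"])
      (use eq ne in \<open>auto simp: sum_less_3 add_ac\<close>)
  ultimately have "\<forall>i<3. A i = 0 \<and> A' i = 0" unfolding all_less_3 by blast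
  then have AA: "A i = 0" "A' i = 0" using i by auto
  define p q r w where "p = 2 * node_prod' h i / node_prod h i ^ 3" and "q = - node_prod h i / node_prod h i ^ 3"
    and "r = (node_prod h i - 2 * h i * node_prod' h i) / node_prod h i ^ 3" and "w = h i * node_prod h i / node_prod h i ^ 3"
  have det: "p * w - q * r \<noteq> 0" unfolding p_def q_def r_def w_def by (rule res_matrix_det) (use i in simp)
  have e: "a i * p + b i * r = 0" "a i * q + b i * w = 0"
    using AA by (simp_all only: A_def A'_def p_def q_def r_def w_def)
  \<comment> \<open>Cramer's rule for the change from points and tangents to the residue
    vectors.\<close>
  have "a i * (p * w - q * r) = (a i * p + b i * r) * w - (a i * q + b i * w) * r"
    "b i * (p * w - q * r) = (a i * q + b i * w) * p - (a i * p + b i * r) * q"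
    by (simp_all add: algebra_simps)
  then show "a i = 0 \<and> b i = 0" using det unfolding e by simp
qed

lemma pencil_det_osc:
  "det3 (\<lambda>i k. row_coord 6 (osc_mat t) (k + 3) (res_const s h i) + v * row_coord 6 (osc_mat t) (k + 3) (res_lin s h i)) =
    (h 0 ^ 2 / node_prod h 0 ^ 3) * (h 1 ^ 2 / node_prod h 1 ^ 3) * (h 2 ^ 2 / node_prod h 2 ^ 3) *
    (-6 * h 3 ^ 2 * ((h 0 - h 1) * (h 0 - h 2) * (h 1 - h 2)) ^ 3 *
     (h 0 * ((v * h 1 - 1) * (v * h 2 - 1) * (v * h 3 - 1)) + h 1 * ((v * h 0 - 1) * (v * h 2 - 1) * (v * h 3 - 1))
      + h 2 * ((v * h 0 - 1) * (v * h 1 - 1) * (v * h 3 - 1)) + h 3 * ((v * h 0 - 1) * (v * h 1 - 1) * (v * h 2 - 1))))"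
proof -
  have *: "row_coord 6 (osc_mat t) (k + 3) (res_const s h i) + v * row_coord 6 (osc_mat t) (k + 3) (res_lin s h i) =
      h i ^ 2 / node_prod h i ^ 3 * (h i ^ k * ((of_nat k + 3) * (v * h i - 1) * node_prod h i
       + h i * (v * node_prod h i - 2 * (v * h i - 1) * node_prod' h i)))" if "k < 3" for i k
  proof -
    have 3: "k + 3 < 6" using that by simp
    have pow: "h i ^ (k + 3 - 1) = h i ^ 2 * h i ^ k" "h i ^ (k + 3) = h i ^ 2 * h i ^ k * h i"
      "h i ^ (Suc (k + 3) - 1) = h i ^ 2 * h i ^ k * h i" "h i ^ Suc (k + 3) = h i ^ 2 * h i ^ k * h i * h i"
      by (simp_all add: power_add eval_nat_numeral)
    show ?thesis unfolding row_coord_res_const[OF 3] row_coord_res_lin[OF 3] pow of_nat_Suc of_nat_add of_nat_numeral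
      by (simp add: add_divide_distrib diff_divide_distrib) (simp add: algebra_simps add_divide_distrib diff_divide_distrib)
  qed
  have "det3 (\<lambda>i k. row_coord 6 (osc_mat t) (k + 3) (res_const s h i) + v * row_coord 6 (osc_mat t) (k + 3) (res_lin s h i)) =
    det3 (\<lambda>i k. h i ^ 2 / node_prod h i ^ 3 * (h i ^ k * ((of_nat k + 3) * (v * h i - 1) * node_prod h i
       + h i * (v * node_prod h i - 2 * (v * h i - 1) * node_prod' h i))))"
    using *[of 0] *[of 1] *[of 2] by (simp add: det3_def)
  then show ?thesis unfolding det3_scale_rows pencil_det_polynomial .
qed

lemma pencil_lead_det_osc:
  "det3 (\<lambda>i k. row_coord 6 (osc_mat t) (k + 3) (res_lin s h i)) \<noteq> 0"
proof -
  have *: "row_coord 6 (osc_mat t) (k + 3) (res_lin s h i) =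
      h i ^ 3 / node_prod h i ^ 3 * (h i ^ k * ((of_nat k + 4) * node_prod h i - 2 * h i * node_prod' h i))" if "k < 3" for i k
  proof -
    have 3: "k + 3 < 6" using that by simp
    have pow: "h i ^ (Suc (k + 3) - 1) = h i ^ 3 * h i ^ k" "h i ^ Suc (k + 3) = h i ^ 3 * h i ^ k * h i"
      by (simp_all add: power_add eval_nat_numeral)
    show ?thesis unfolding row_coord_res_lin[OF 3] pow of_nat_Suc of_nat_add of_nat_numeral
      by (simp add: add_divide_distrib diff_divide_distrib) (simp add: algebra_simps add_divide_distrib diff_divide_distrib)
  qed
  have "det3 (\<lambda>i k. row_coord 6 (osc_mat t) (k + 3) (res_lin s h i)) =
    det3 (\<lambda>i k. h i ^ 3 / node_prod h i ^ 3 * (h i ^ k * ((of_nat k + 4) * node_prod h i - 2 * h i * node_prod' h i)))"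
    using *[of 0] *[of 1] *[of 2] by (simp add: det3_def)
  also have "\<dots> \<noteq> 0" unfolding det3_scale_rows pencil_lead_det_polynomial
    using nz node_prod_nz inj by (auto simp: inj_on_def lessThan_4)
  finally show ?thesis .
qed

end

text \<open>For real parameters the residue vectors have real entries, so a real root
  \<open>v\<close> of the cubic gives a real basis of the corresponding point.\<close>

lemma osculating_schubert_inter:
  fixes s :: "nat \<Rightarrow> real"
  assumes inj: "inj_on s {..<5}"
  defines "I \<equiv> schubert_inter 3 6 four_lines_and_plane (\<lambda>j. osc_flag 6 (complex_of_real (s j)))"
  shows "finite I \<and> card I = 3 \<and> (\<forall>X\<in>I. real_point X)"
proof -
  define h where "h i = s i - s 4" for i
  let ?s = "\<lambda>i. complex_of_real (s i)" and ?h = "\<lambda>i. complex_of_real (h i)"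
  have injh: "inj_on h {..<4}" and nz: "h i \<noteq> 0" if "i < 4" for i
    using inj that by (force simp: h_def inj_on_def)+
  interpret osculating_lines ?s ?h "?s 4"
    by unfold_locales (use injh[of 0] nz in \<open>auto simp: h_def inj_on_def\<close>)
  let ?x = "res_const ?s ?h" and ?y = "res_lin ?s ?h"
  obtain R where R: "finite R" "card R = 3"
    "{v::complex. ?h 0 * ((v * ?h 1 - 1) * (v * ?h 2 - 1) * (v * ?h 3 - 1)) + ?h 1 * ((v * ?h 0 - 1) * (v * ?h 2 - 1) * (v * ?h 3 - 1))
      + ?h 2 * ((v * ?h 0 - 1) * (v * ?h 1 - 1) * (v * ?h 3 - 1)) + ?h 3 * ((v * ?h 0 - 1) * (v * ?h 1 - 1) * (v * ?h 2 - 1)) = 0}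
      = complex_of_real ` R"
    using reciprocal_quartic_critical_points[of h] injh[of 0] nz by auto
  have const: "(?h 0 ^ 2 / node_prod ?h 0 ^ 3) * (?h 1 ^ 2 / node_prod ?h 1 ^ 3) * (?h 2 ^ 2 / node_prod ?h 2 ^ 3) \<noteq> 0"
    "-6 * ?h 3 ^ 2 * ((?h 0 - ?h 1) * (?h 0 - ?h 2) * (?h 1 - ?h 2)) ^ 3 \<noteq> 0"
    using nz node_prod_nz injh[of 0] by (auto simp: inj_on_def lessThan_4)
  have roots: "{v. det3 (\<lambda>i k. row_coord 6 (osc_mat (?s 4)) (k + 3) (?x i) + v * row_coord 6 (osc_mat (?s 4)) (k + 3) (?y i)) = 0}
      = complex_of_real ` R"
    unfolding pencil_det_osc mult_eq_0_iff[of "_ * _ * _" "_ * _"] mult_eq_0_iff[of "-6 * _ * _"] R(3) [symmetric]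
    using const by auto
  have S: "I = schubert_inter 3 6 four_lines_and_plane (\<lambda>j. row_flag 6 (osc_mat (?s j)))"
    unfolding I_def osc_flag_eq ..
  have Rc: "finite (complex_of_real ` R)" "card (complex_of_real ` R) = 3"
    using R(1,2) by (simp_all add: card_image inj_on_def)
  have L: "row_flag 6 (osc_mat (?s i)) 2 = span2 (?x i) (?y i)" if "i < 3" for i
    using osc_flag_line[of i] that by simp
  have D: "nmat_det 6 (osc_mat (?s j)) \<noteq> 0" for j by simp
  have "finite I" "card I = 3" unfolding S
    using card_schubert_inter_pencil[of ?x ?y "\<lambda>j. osc_mat (?s j)", OF pair_indep_res res_in_Cn D L
        osc_flag_last_line pencil_lead_det_osc Rc roots] by auto
  moreover have "real_point X" if XI: "X \<in> I" for X
  proof -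
    have "I = (\<lambda>v. cspan (pencil ?x ?y 1 v ` {..<3})) ` complex_of_real ` R"
      unfolding S using schubert_inter_pencil[of ?x ?y "\<lambda>j. osc_mat (?s j)", OF pair_indep_res res_in_Cn D L
        osc_flag_last_line pencil_lead_det_osc] by (simp only: roots)
    then obtain v where v: "X = cspan (pencil ?x ?y 1 (complex_of_real v) ` {..<3})" using XI by auto
    have "?x i c \<in> \<real>" "?y i c \<in> \<real>" for i c
      unfolding res_const_def res_lin_def node_prod_def node_prod'_def osc_mat_def
      by (auto simp: cscale_apply intro!: Reals_add Reals_mult Reals_divide Reals_power Reals_diff Reals_minus prod_in_Reals sum_in_Reals)
    then have "pencil ?x ?y 1 (complex_of_real v) i c \<in> \<real>" for i c
      by (simp add: pencil_def cscale_apply)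
    with v show ?thesis unfolding real_point_def by (intro exI[of _ "pencil ?x ?y 1 (complex_of_real v) ` {..<3}"]) auto
  qed
  ultimately show ?thesis by blast
qed

section \<open>Polynomial functions\<close>

lemma poly_fun_uminus: "poly_fun V f \<Longrightarrow> poly_fun V (\<lambda>x. - f x)"
  using pf_mult[OF pf_const[of V "-1"], of f] by simp

lemma poly_fun_diff: "poly_fun V f \<Longrightarrow> poly_fun V g \<Longrightarrow> poly_fun V (\<lambda>x. f x - g x)"
  using pf_add[OF _ poly_fun_uminus, of V f g] by simp

lemma poly_fun_sum: "(\<And>i. i \<in> A \<Longrightarrow> poly_fun V (f i)) \<Longrightarrow> poly_fun V (\<lambda>x. \<Sum>i\<in>A. f i x)"
  by (induction A rule: infinite_finite_induct) (auto intro: poly_fun.intros)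

lemma poly_fun_prod: "(\<And>i. i \<in> A \<Longrightarrow> poly_fun V (f i)) \<Longrightarrow> poly_fun V (\<lambda>x. \<Prod>i\<in>A. f i x)"
  by (induction A rule: infinite_finite_induct) (auto intro: poly_fun.intros)

lemma poly_fun_power: "poly_fun V f \<Longrightarrow> poly_fun V (\<lambda>x. f x ^ n)"
  by (induction n) (auto intro: poly_fun.intros)

lemmas poly_fun_intros = pf_const pf_var pf_add pf_mult poly_fun_uminus poly_fun_diff poly_fun_sum
  poly_fun_prod poly_fun_power

lemma poly_fun_nmat_det:
  assumes "\<And>i j. i < n \<Longrightarrow> j < n \<Longrightarrow> poly_fun V (\<lambda>x. F x i j)"
  shows "poly_fun V (\<lambda>x. nmat_det n (F x))"
proof -
  have "nmat_det n (F x) = (\<Sum>p\<in>{p. p permutes {0..<n}}. signof p * (\<Prod>i\<in>{0..<n}. F x i (p i)))" for x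
    unfolding nmat_det_def by (subst det_def'[of _ n]) (auto intro!: sum.cong prod.cong dest: permutes_in_image)
  then show ?thesis using assms
    by (simp, intro poly_fun_intros) (auto dest: permutes_in_image)
qed

lemma nmat_adj_cofactor:
  assumes "i < n" "j < n"
  shows "nmat_adj n g i j = (-1) ^ (j + i) *
    nmat_det (n - 1) (\<lambda>i' j'. g (if i' < j then i' else Suc i') (if j' < i then j' else Suc j'))"
proof -
  have "mat_delete (Matrix.mat n n (\<lambda>(i, j). g i j)) j i =
    Matrix.mat (n - 1) (n - 1) (\<lambda>(i', j'). g (if i' < j then i' else Suc i') (if j' < i then j' else Suc j'))"
    unfolding mat_delete_def by (rule eq_matI) auto
  then show ?thesis using assms by (simp add: nmat_adj_def adj_mat_def cofactor_def nmat_det_def)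
qed

lemma poly_fun_nmat_adj:
  assumes "\<And>i j. i < n \<Longrightarrow> j < n \<Longrightarrow> poly_fun V (\<lambda>x. F x i j)" "i < n" "j < n"
  shows "poly_fun V (\<lambda>x. nmat_adj n (F x) i j)"
  unfolding nmat_adj_cofactor[OF assms(2,3)]
  by (intro poly_fun_intros poly_fun_nmat_det assms(1)) (use assms(2,3) in auto)

lemma poly_fun_det3:
  "(\<And>i k. i < 3 \<Longrightarrow> k < 3 \<Longrightarrow> poly_fun V (\<lambda>x. F x i k)) \<Longrightarrow> poly_fun V (\<lambda>x. det3 (F x))"
  unfolding det3_def by (intro poly_fun_intros) auto

lemma poly_fun_row_coord:
  assumes "\<And>i j. i < n \<Longrightarrow> j < n \<Longrightarrow> poly_fun V (\<lambda>x. F x i j)" "\<And>j. j < n \<Longrightarrow> poly_fun V (\<lambda>x. w x j)" "k < n"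
  shows "poly_fun V (\<lambda>x. row_coord n (F x) k (w x))"
  unfolding row_coord_def by (intro poly_fun_intros poly_fun_nmat_adj assms) (use assms(3) in auto)

lemma poly_fun_line:
  assumes "poly_fun V f"
  shows "\<exists>p :: 'a::comm_ring_1 poly. \<forall>t. f (\<lambda>i. x i + t * (y i - x i)) = poly p t"
  using assms
proof induction
  case (pf_const c)
  then show ?case by (intro exI[of _ "[:c:]"]) simp
next
  case (pf_var v)
  then show ?case by (intro exI[of _ "[:x v, y v - x v:]"]) simp
next
  case (pf_add f g)
  then show ?case by (metis poly_add)
next
  case (pf_mult f g)
  then show ?case by (metis poly_mult)
qed

text \<open>Restricting to the line through a non-zero of $f$ and a non-zero of $g$ reduces this to
  univariate polynomials.\<close>
lemma poly_fun_mult_nonzero: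
  fixes f g :: "('v \<Rightarrow> 'a::{idom,ring_char_0}) \<Rightarrow> 'a"
  assumes "poly_fun V f" "poly_fun V g" "f x \<noteq> 0" "g y \<noteq> 0"
  shows "\<exists>z. f z * g z \<noteq> 0"
proof -
  let ?l = "\<lambda>t i. x i + t * (y i - x i)"
  obtain p q where p: "\<And>t. f (?l t) = poly p t" and q: "\<And>t. g (?l t) = poly q t"
    using poly_fun_line[OF assms(1)] poly_fun_line[OF assms(2)] by meson
  have "poly p 0 \<noteq> 0" "poly q 1 \<noteq> 0" using assms(3,4) p[of 0] q[of 1] by auto
  then have "p * q \<noteq> 0" by auto
  then have "finite {t. poly (p * q) t = 0}" by (rule poly_roots_finite)
  then obtain t where "poly (p * q) t \<noteq> 0"
    using ex_new_if_finite[OF infinite_UNIV_char_0] by blast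
  then show ?thesis using p q by (metis poly_mult)
qed

lemma poly_fun_prod_nonzero:
  fixes f :: "'b \<Rightarrow> ('v \<Rightarrow> 'a::{idom,ring_char_0}) \<Rightarrow> 'a"
  assumes "finite A" "\<And>i. i \<in> A \<Longrightarrow> poly_fun V (f i)" "\<And>i. i \<in> A \<Longrightarrow> \<exists>x. f i x \<noteq> 0"
  shows "\<exists>z. (\<Prod>i\<in>A. f i z) \<noteq> 0"
  using assms
proof (induction A)
  case (insert a A)
  then obtain x y where "f a x \<noteq> 0" "(\<Prod>i\<in>A. f i y) \<noteq> 0" by fastforce
  then have "\<exists>z. f a z * (\<Prod>i\<in>A. f i z) \<noteq> 0"
    by (intro poly_fun_mult_nonzero[of V _ _ x y]) (use insert.prems in \<open>auto intro: poly_fun_prod\<close>)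
  then show ?case using insert.hyps by simp
qed simp

section \<open>Uniqueness of the generic count\<close>

lemma nmat_det_delta: "nmat_det n (\<lambda>i j. if i = j then 1 else 0) = (1 :: 'a::comm_ring_1)"
proof -
  have "Matrix.mat n n (\<lambda>(i, j). if i = j then 1 else 0) = (1\<^sub>m n :: 'a mat)" by (rule eq_matI) auto
  then show ?thesis by (simp add: nmat_det_def)
qed

lemma exists_nmat_det_prod_nonzero:
  "\<exists>x. (\<Prod>j<(k::nat). nmat_det n (\<lambda>a b. x (j, a, b))) \<noteq> (0 :: 'a::{idom,ring_char_0})"
proof (rule poly_fun_prod_nonzero[where V = UNIV])
  fix j
  show "\<exists>x. nmat_det n (\<lambda>a b. x (j, a, b)) \<noteq> (0 :: 'a)"
    by (rule exI[of _ "\<lambda>(j, a, b). if a = b then 1 else 0"]) (simp add: nmat_det_delta)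
  show "poly_fun UNIV (\<lambda>x. nmat_det n (\<lambda>a b. x (j, a, b)) :: 'a)"
    by (intro poly_fun_nmat_det poly_fun_intros) simp
qed simp

text \<open>The two certifying polynomials and the determinants have a common point where none
  vanishes; for the flags given by that point both counts apply.\<close>

lemma generic_count_unique:
  assumes "generic_count m p \<alpha>s N" "generic_count m p \<alpha>s N'"
  shows "N = N'"
proof -
  let ?n = "m + p" and ?k = "length \<alpha>s"
  let ?V = "{..<?k} \<times> {..<?n} \<times> {..<?n}"
  let ?D = "\<lambda>x::nat \<times> nat \<times> nat \<Rightarrow> complex. \<Prod>j<?k. nmat_det ?n (\<lambda>a b. x (j, a, b))"
  obtain P where P: "poly_fun ?V P" "\<exists>x. P x \<noteq> 0"
    "\<And>gs. (\<forall>j<?k. Defs.invertible_mat ?n (gs j)) \<and> P (\<lambda>(j, a, b). gs j a b) \<noteq> 0 \<Longrightarrow>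
      card (schubert_inter p ?n \<alpha>s (\<lambda>j. row_flag ?n (gs j))) = N"
    using assms(1) unfolding generic_count_def Let_def by blast
  obtain P' where P': "poly_fun ?V P'" "\<exists>x. P' x \<noteq> 0"
    "\<And>gs. (\<forall>j<?k. Defs.invertible_mat ?n (gs j)) \<and> P' (\<lambda>(j, a, b). gs j a b) \<noteq> 0 \<Longrightarrow>
      card (schubert_inter p ?n \<alpha>s (\<lambda>j. row_flag ?n (gs j))) = N'"
    using assms(2) unfolding generic_count_def Let_def by blast
  have D: "poly_fun ?V ?D"
    by (intro poly_fun_prod poly_fun_nmat_det pf_var) auto
  obtain y where "P y * P' y \<noteq> 0" using poly_fun_mult_nonzero[OF P(1) P'(1)] P(2) P'(2) by blast
  moreover obtain w where "?D w \<noteq> 0"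
    using exists_nmat_det_prod_nonzero[of ?n ?k] by auto
  ultimately obtain x where "(P x * P' x) * ?D x \<noteq> 0"
    using poly_fun_mult_nonzero[OF pf_mult[OF P(1) P'(1)] D, of y w] by auto
  then have x: "P x \<noteq> 0" "P' x \<noteq> 0" "\<And>j. j < ?k \<Longrightarrow> nmat_det ?n (\<lambda>a b. x (j, a, b)) \<noteq> 0" by auto
  have eta: "(\<lambda>(j, a, b). x (j, a, b)) = x" by auto
  have "\<forall>j<?k. Defs.invertible_mat ?n (\<lambda>a b. x (j, a, b))" using x(3) by (auto intro: invertible_mat_if_det)
  then show ?thesis using P(3)[of "\<lambda>j a b. x (j, a, b)"] P'(3)[of "\<lambda>j a b. x (j, a, b)"] x(1,2) by (simp add: eta)
qed

section \<open>Flags in general position\<close>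

definition mix_det3 :: "nat set \<Rightarrow> (nat \<Rightarrow> nat \<Rightarrow> 'a::comm_ring_1) \<Rightarrow> (nat \<Rightarrow> nat \<Rightarrow> 'a) \<Rightarrow> 'a" where
  "mix_det3 S \<alpha> \<beta> = det3 (\<lambda>i k. if i \<in> S then \<beta> i k else \<alpha> i k)"

text \<open>The coefficient of v^d in det (\<alpha> + v \<beta>), by multilinearity in the rows:
  \<open>S\<close> is the set of rows taken from \<open>\<beta>\<close>. In this form it is visibly
  polynomial in the entries of both matrices.\<close>

definition pencil_coeff :: "nat \<Rightarrow> (nat \<Rightarrow> nat \<Rightarrow> 'a::comm_ring_1) \<Rightarrow> (nat \<Rightarrow> nat \<Rightarrow> 'a) \<Rightarrow> 'a" where
  "pencil_coeff d \<alpha> \<beta> = (\<Sum>S\<in>{S \<in> Pow {..<3}. card S = d}. mix_det3 S \<alpha> \<beta>)"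

lemma pencil_coeff_simps:
  "pencil_coeff 0 \<alpha> \<beta> = mix_det3 {} \<alpha> \<beta>"
  "pencil_coeff 1 \<alpha> \<beta> = mix_det3 {0} \<alpha> \<beta> + mix_det3 {1} \<alpha> \<beta> + mix_det3 {2} \<alpha> \<beta>"
  "pencil_coeff 2 \<alpha> \<beta> = mix_det3 {0, 1} \<alpha> \<beta> + mix_det3 {0, 2} \<alpha> \<beta> + mix_det3 {1, 2} \<alpha> \<beta>"
  "pencil_coeff 3 \<alpha> \<beta> = mix_det3 {0, 1, 2} \<alpha> \<beta>"
proof -
  have 3: "{..<3::nat} = {0, 1, 2}" by auto
  have "{S \<in> Pow {..<3::nat}. card S = 0} = {{}}"
    "{S \<in> Pow {..<3::nat}. card S = 1} = {{0}, {1}, {2}}"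
    "{S \<in> Pow {..<3::nat}. card S = 2} = {{0, 1}, {0, 2}, {1, 2}}"
    "{S \<in> Pow {..<3::nat}. card S = 3} = {{0, 1, 2}}"
    unfolding 3 by (auto simp: Pow_insert)
  then show "pencil_coeff 0 \<alpha> \<beta> = mix_det3 {} \<alpha> \<beta>"
    "pencil_coeff 1 \<alpha> \<beta> = mix_det3 {0} \<alpha> \<beta> + mix_det3 {1} \<alpha> \<beta> + mix_det3 {2} \<alpha> \<beta>"
    "pencil_coeff 2 \<alpha> \<beta> = mix_det3 {0, 1} \<alpha> \<beta> + mix_det3 {0, 2} \<alpha> \<beta> + mix_det3 {1, 2} \<alpha> \<beta>"
    "pencil_coeff 3 \<alpha> \<beta> = mix_det3 {0, 1, 2} \<alpha> \<beta>"
    unfolding pencil_coeff_def by (simp_all add: add.assoc doubleton_eq_iff)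
qed

lemma det3_pencil:
  "det3 (\<lambda>i k. \<alpha> i k + v * \<beta> i k) = pencil_coeff 0 \<alpha> \<beta> + pencil_coeff 1 \<alpha> \<beta> * v
     + pencil_coeff 2 \<alpha> \<beta> * v ^ 2 + pencil_coeff 3 \<alpha> \<beta> * v ^ 3"
  unfolding pencil_coeff_simps mix_det3_def det3_def by (simp add: algebra_simps power2_eq_square power3_eq_cube)

lemma pencil_coeff_3: "pencil_coeff 3 \<alpha> \<beta> = det3 \<beta>"
  unfolding pencil_coeff_simps mix_det3_def det3_def by simp

definition cubic_disc :: "'a::comm_ring_1 \<Rightarrow> 'a \<Rightarrow> 'a \<Rightarrow> 'a \<Rightarrow> 'a" where
  "cubic_disc c0 c1 c2 c3 = c1^2 * c2^2 - 4 * c1^3 * c3 - 4 * c0 * c2^3 - 27 * c0^2 * c3^2 + 18 * c0 * c1 * c2 * c3"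

text \<open>Once the cubic is split into linear factors, the discriminant is \<open>c3 ^ 4\<close>
  times the squared product of the differences of the roots.\<close>

lemma cubic_zeros_card:
  fixes c0 c1 c2 c3 :: complex
  assumes c3: "c3 \<noteq> 0" and disc: "cubic_disc c0 c1 c2 c3 \<noteq> 0"
  shows "finite {v. c0 + c1 * v + c2 * v^2 + c3 * v^3 = 0}" "card {v. c0 + c1 * v + c2 * v^2 + c3 * v^3 = 0} = 3"
proof -
  obtain a where "poly [:c0, c1, c2, c3:] a = 0" using alg_closed_imp_poly_has_root[of "[:c0, c1, c2, c3:]"] c3 by auto
  then have a: "c0 = - (c1 * a + c2 * a^2 + c3 * a^3)"
    by (simp add: eq_neg_iff_add_eq_0 algebra_simps power2_eq_square power3_eq_cube)
  \<comment> \<open>The quadratic is the quotient of the cubic by v - a, from synthetic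
    division.\<close>
  obtain b where "poly [:c1 + c2 * a + c3 * a^2, c2 + c3 * a, c3:] b = 0"
    using alg_closed_imp_poly_has_root[of "[:c1 + c2 * a + c3 * a^2, c2 + c3 * a, c3:]"] c3 by auto
  then have b: "c1 = - (c2 * a + c3 * a^2 + (c2 + c3 * a) * b + c3 * b^2)"
    by (simp add: eq_neg_iff_add_eq_0 algebra_simps power2_eq_square)
  \<comment> \<open>The third root, chosen so that the roots add up to
    \<open>- c2 / c3\<close>.\<close>
  define c where "c = - (c2 + c3 * a + c3 * b) / c3"
  have c2: "c2 = - (c3 * (a + b + c))" using c3 by (simp add: c_def field_simps)
  have c1: "c1 = c3 * (a * b + a * c + b * c)" unfolding b c2 by Groebner_Basis.algebra
  have c0: "c0 = - (c3 * a * b * c)" unfolding a c1 c2 by Groebner_Basis.algebra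
  have "c0 + c1 * v + c2 * v^2 + c3 * v^3 = c3 * ((v - a) * (v - b) * (v - c))" for v
    unfolding c0 c1 c2 by Groebner_Basis.algebra
  then have S: "{v. c0 + c1 * v + c2 * v^2 + c3 * v^3 = 0} = {a, b, c}" using c3 by auto
  have "cubic_disc c0 c1 c2 c3 = c3^4 * ((a - b) * (a - c) * (b - c))^2"
    unfolding c0 c1 c2 cubic_disc_def by Groebner_Basis.algebra
  then have "a \<noteq> b" "a \<noteq> c" "b \<noteq> c" using disc by auto
  then show "finite {v. c0 + c1 * v + c2 * v^2 + c3 * v^3 = 0}" "card {v. c0 + c1 * v + c2 * v^2 + c3 * v^3 = 0} = 3"
    unfolding S by simp_all
qed

type_synonym flags = "nat \<Rightarrow> nat \<Rightarrow> nat \<Rightarrow> complex"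

text \<open>Rows $r$ and $r+3$ are the vectors spanning the $r$-th line, so that the identity matrix
  arises from a sum of three coordinate lines.\<close>
definition line_mat :: "flags \<Rightarrow> nat \<Rightarrow> nat \<Rightarrow> complex" where
  "line_mat gs r = (if r < 3 then gs r 0 else gs (r - 3) 1)"

definition fourth_coord :: "flags \<Rightarrow> nat \<Rightarrow> nat \<Rightarrow> complex" where
  "fourth_coord gs e r = row_coord 6 (line_mat gs) r (gs 3 e)"

text \<open>The component in the \<open>i\<close>-th line of the \<open>e\<close>-th vector spanning
  the fourth line, times the determinant of \<open>line_mat gs\<close>. These are the x_i for
  \<open>e = 0\<close> and the y_i for \<open>e = 1\<close>.\<close>

definition fourth_part :: "flags \<Rightarrow> nat \<Rightarrow> nat \<Rightarrow> nat \<Rightarrow> complex" where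
  "fourth_part gs e i = cscale (fourth_coord gs e i) (trunc_row 6 (gs i) 0)
     + cscale (fourth_coord gs e (i + 3)) (trunc_row 6 (gs i) 1)"

definition part_minor :: "flags \<Rightarrow> nat \<Rightarrow> complex" where
  "part_minor gs i = fourth_coord gs 0 i * fourth_coord gs 1 (i + 3) - fourth_coord gs 0 (i + 3) * fourth_coord gs 1 i"

definition part_coord :: "flags \<Rightarrow> nat \<Rightarrow> nat \<Rightarrow> nat \<Rightarrow> complex" where
  "part_coord gs e i k = row_coord 6 (gs 4) (k + 3) (fourth_part gs e i)"

text \<open>The factors express in turn that the first three lines span C^6, that the fourth line
  projects isomorphically onto each of them, that v = infinity is no solution, and that the cubic
  has distinct roots.\<close>

definition generic_poly :: "flags \<Rightarrow> complex" where
  "generic_poly gs = nmat_det 6 (line_mat gs) * (\<Prod>i<3. part_minor gs i) *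
     pencil_coeff 3 (part_coord gs 0) (part_coord gs 1) *
     cubic_disc (pencil_coeff 0 (part_coord gs 0) (part_coord gs 1)) (pencil_coeff 1 (part_coord gs 0) (part_coord gs 1))
       (pencil_coeff 2 (part_coord gs 0) (part_coord gs 1)) (pencil_coeff 3 (part_coord gs 0) (part_coord gs 1))"

lemma row_coord_trunc: "row_coord n g k (trunc_row n f e) = row_coord n g k (f e)"
  by (simp add: row_coord_def)

lemma sum_six_as_pairs: "(\<Sum>r<6::nat. f r) = (\<Sum>i<3. f i + f (i + 3))"
  for f :: "nat \<Rightarrow> 'a::comm_monoid_add"
  by (simp add: eval_nat_numeral ac_simps)

lemma trunc_row_line_mat:
  "i < 3 \<Longrightarrow> trunc_row 6 (line_mat gs) i = trunc_row 6 (gs i) 0"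
  "trunc_row 6 (line_mat gs) (i + 3) = trunc_row 6 (gs i) 1"
  unfolding line_mat_def by auto

lemma sum_fourth_part:
  "(\<Sum>i<3. fourth_part gs e i) = cscale (nmat_det 6 (line_mat gs)) (trunc_row 6 (gs 3) e)"
proof -
  have "trunc_row 6 (gs 3) e \<in> Cn 6" by (simp add: Cn_def)
  note row_expansion[OF this, of "line_mat gs"]
  also have "(\<Sum>r<6. cscale (row_coord 6 (line_mat gs) r (trunc_row 6 (gs 3) e)) (trunc_row 6 (line_mat gs) r))
    = (\<Sum>i<3. fourth_part gs e i)"
    unfolding sum_six_as_pairs row_coord_trunc trunc_row_line_mat(2)
    by (rule sum.cong) (simp_all add: fourth_part_def fourth_coord_def trunc_row_line_mat(1))
  finally show ?thesis ..
qed

lemma pair_indep_fourth_part: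
  assumes A: "nmat_det 6 (line_mat gs) \<noteq> 0" and m: "\<And>i. i < 3 \<Longrightarrow> part_minor gs i \<noteq> 0"
  shows "pair_indep 3 (fourth_part gs 0) (fourth_part gs 1)"
  unfolding pair_indep_def
proof (intro allI impI)
  fix a b i assume z: "(\<Sum>i<3. cscale (a i) (fourth_part gs 0 i) + cscale (b i) (fourth_part gs 1 i)) = 0" and i: "i < (3::nat)"
  define c where "c r = (if r < 3 then a r * fourth_coord gs 0 r + b r * fourth_coord gs 1 r
      else a (r - 3) * fourth_coord gs 0 r + b (r - 3) * fourth_coord gs 1 r)" for r
  have c: "c i = a i * fourth_coord gs 0 i + b i * fourth_coord gs 1 i" if "i < 3" for i
    using that by (simp add: c_def)
  have c': "c (i + 3) = a i * fourth_coord gs 0 (i + 3) + b i * fourth_coord gs 1 (i + 3)" for i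
    by (simp add: c_def)
  have "(\<Sum>r<6. cscale (c r) (trunc_row 6 (line_mat gs) r)) =
     (\<Sum>i<3. cscale (a i) (fourth_part gs 0 i) + cscale (b i) (fourth_part gs 1 i))"
    unfolding sum_six_as_pairs trunc_row_line_mat(2)
  proof (rule sum.cong)
    fix i :: nat assume "i \<in> {..<3}"
    then have i: "i < 3" by simp
    show "cscale (c i) (trunc_row 6 (line_mat gs) i) + cscale (c (i + 3)) (trunc_row 6 (gs i) 1) =
        cscale (a i) (fourth_part gs 0 i) + cscale (b i) (fourth_part gs 1 i)"
      unfolding trunc_row_line_mat(1)[OF i] c[OF i] c' fourth_part_def comb_pairs cv.scale_left_distrib
      by (simp only: add_ac)
  qed simp
  then have "\<forall>r<6. c r = 0" using lin_indep_rows[OF A, of 6] z unfolding lin_indep_def by simp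
  then have "c i = 0" "c (i + 3) = 0" using i by auto
  then have e: "a i * fourth_coord gs 0 i + b i * fourth_coord gs 1 i = 0"
    "a i * fourth_coord gs 0 (i + 3) + b i * fourth_coord gs 1 (i + 3) = 0"
    using c[OF i] c' by simp_all
  have "a i * part_minor gs i = (a i * fourth_coord gs 0 i + b i * fourth_coord gs 1 i) * fourth_coord gs 1 (i + 3)
      - (a i * fourth_coord gs 0 (i + 3) + b i * fourth_coord gs 1 (i + 3)) * fourth_coord gs 1 i"
    "b i * part_minor gs i = (a i * fourth_coord gs 0 (i + 3) + b i * fourth_coord gs 1 (i + 3)) * fourth_coord gs 0 i
      - (a i * fourth_coord gs 0 i + b i * fourth_coord gs 1 i) * fourth_coord gs 0 (i + 3)"
    by (simp_all add: part_minor_def algebra_simps)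
  then show "a i = 0 \<and> b i = 0" using m[OF i] unfolding e by simp
qed

lemma generic_schubert_inter:
  assumes g: "\<And>j. j < 5 \<Longrightarrow> nmat_det 6 (gs j) \<noteq> 0" and P: "generic_poly gs \<noteq> 0"
  shows "finite (schubert_inter 3 6 four_lines_and_plane (\<lambda>j. row_flag 6 (gs j)))"
    "card (schubert_inter 3 6 four_lines_and_plane (\<lambda>j. row_flag 6 (gs j))) = 3"
proof -
  have A: "nmat_det 6 (line_mat gs) \<noteq> 0" and m: "\<And>i. i < 3 \<Longrightarrow> part_minor gs i \<noteq> 0"
    and lead: "pencil_coeff 3 (part_coord gs 0) (part_coord gs 1) \<noteq> 0"
    and disc: "cubic_disc (pencil_coeff 0 (part_coord gs 0) (part_coord gs 1)) (pencil_coeff 1 (part_coord gs 0) (part_coord gs 1))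
       (pencil_coeff 2 (part_coord gs 0) (part_coord gs 1)) (pencil_coeff 3 (part_coord gs 0) (part_coord gs 1)) \<noteq> 0"
    using P by (auto simp: generic_poly_def)
  let ?R = "{v. det3 (\<lambda>i k. part_coord gs 0 i k + v * part_coord gs 1 i k) = 0}"
  have R: "finite ?R" "card ?R = 3"
    unfolding det3_pencil using cubic_zeros_card[OF lead disc] by simp_all
  have L: "row_flag 6 (gs i) 2 = span2 (fourth_part gs 0 i) (fourth_part gs 1 i)" if "i < 3" for i
    unfolding row_flag_2 fourth_part_def
    by (rule span2_change_basis[symmetric]) (use m[OF that] in \<open>simp add: part_minor_def\<close>)
  have L3: "row_flag 6 (gs 3) 2 = span2 (\<Sum>i<3. fourth_part gs 0 i) (\<Sum>i<3. fourth_part gs 1 i)"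
    unfolding row_flag_2 sum_fourth_part
    using span2_change_basis[of "nmat_det 6 (line_mat gs)" "nmat_det 6 (line_mat gs)" 0 0] A by simp
  have Cn: "fourth_part gs e i \<in> Cn 6" for e i by (simp add: fourth_part_def Cn_def cscale_apply)
  have lead': "det3 (\<lambda>i k. row_coord 6 (gs 4) (k + 3) (fourth_part gs 1 i)) \<noteq> 0"
    using lead by (simp add: pencil_coeff_3 part_coord_def [abs_def])
  have R': "{v. det3 (\<lambda>i k. row_coord 6 (gs 4) (k + 3) (fourth_part gs 0 i) + v * row_coord 6 (gs 4) (k + 3) (fourth_part gs 1 i)) = 0} = ?R"
    by (simp add: part_coord_def)
  note * = card_schubert_inter_pencil[OF pair_indep_fourth_part[OF A m] Cn Cn g L L3 lead' R R']
  show "finite (schubert_inter 3 6 four_lines_and_plane (\<lambda>j. row_flag 6 (gs j)))" by (rule *(1))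
  show "card (schubert_inter 3 6 four_lines_and_plane (\<lambda>j. row_flag 6 (gs j))) = 3" by (rule *(2))
qed

lemma poly_fun_generic_poly:
  "poly_fun ({..<5} \<times> {..<6} \<times> {..<6}) (\<lambda>x. generic_poly (\<lambda>j a b. x (j, a, b)))"
proof -
  let ?V = "{..<5} \<times> {..<6} \<times> {..<6::nat}" and ?g = "\<lambda>(x::nat \<times> nat \<times> nat \<Rightarrow> complex) j a b. x (j, a, b)"
  have lm: "poly_fun ?V (\<lambda>x. line_mat (?g x) i j)" if "i < 6" "j < 6" for i j
    unfolding line_mat_def using that by (cases "i < 3") (auto intro!: pf_var)
  have fc: "poly_fun ?V (\<lambda>x. fourth_coord (?g x) e r)" if "e < 2" "r < 6" for e r
    unfolding fourth_coord_def by (rule poly_fun_row_coord[OF lm]) (use that in \<open>auto intro: pf_var\<close>)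
  have pm: "poly_fun ?V (\<lambda>x. part_minor (?g x) i)" if "i < 3" for i
    unfolding part_minor_def by (intro poly_fun_intros fc) (use that in auto)
  have fp: "poly_fun ?V (\<lambda>x. fourth_part (?g x) e i j)" if "e < 2" "i < 3" "j < 6" for e i j
    unfolding fourth_part_def plus_fun_apply cscale_apply using that by (auto intro!: poly_fun_intros fc)
  have pc: "poly_fun ?V (\<lambda>x. part_coord (?g x) e i k)" if "e < 2" "i < 3" "k < 3" for e i k
    unfolding part_coord_def by (rule poly_fun_row_coord) (use that in \<open>auto intro: pf_var fp\<close>)
  have mx: "poly_fun ?V (\<lambda>x. mix_det3 S (part_coord (?g x) 0) (part_coord (?g x) 1))" for S
    unfolding mix_det3_def
  proof (rule poly_fun_det3)
    fix i k :: nat assume "i < 3" "k < 3"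
    then show "poly_fun ?V (\<lambda>x. if i \<in> S then part_coord (?g x) 1 i k else part_coord (?g x) 0 i k)"
      by (cases "i \<in> S") (simp_all add: pc)
  qed
  have co: "poly_fun ?V (\<lambda>x. pencil_coeff d (part_coord (?g x) 0) (part_coord (?g x) 1))" for d
    unfolding pencil_coeff_def by (intro poly_fun_sum mx)
  show ?thesis
    unfolding generic_poly_def cubic_disc_def
    by (intro poly_fun_intros poly_fun_nmat_det lm pm co) auto
qed

section \<open>A configuration at which \<open>generic_poly\<close> does not vanish\<close>

lemma nmat_cong:
  assumes "\<And>i j. i < n \<Longrightarrow> j < n \<Longrightarrow> g i j = g' i j"
  shows "nmat_det n g = nmat_det n g'" "nmat_adj n g = nmat_adj n g'"
proof -
  have "Matrix.mat n n (\<lambda>(i, j). g i j) = Matrix.mat n n (\<lambda>(i, j). g' i j)"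
    by (rule eq_matI) (auto simp: assms)
  then show "nmat_det n g = nmat_det n g'" "nmat_adj n g = nmat_adj n g'"
    by (simp_all add: nmat_det_def nmat_adj_def fun_eq_iff)
qed

lemma nmat_adj_delta:
  assumes "i < n" "k < n"
  shows "nmat_adj n (\<lambda>i j. if i = j then 1 else 0) i k = (if i = k then 1 else (0::'a::comm_ring_1))"
proof -
  have "(\<Sum>j<n. nmat_adj n (\<lambda>i j. if i = j then 1 else 0) i j * (if j = k then 1 else (0::'a))) =
     (\<Sum>j<n. if j = k then nmat_adj n (\<lambda>i j. if i = j then 1 else 0) i k else 0)"
    by (intro sum.cong) auto
  then show ?thesis using nmat_adj_left[OF assms, of "\<lambda>i j. if i = j then 1 else (0::'a)"] assms
    by (auto simp: nmat_det_delta split: if_splits)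
qed

lemma row_coord_delta:
  assumes "k < n"
  shows "row_coord n (\<lambda>i j. if i = j then 1 else 0) k w = w k"
proof -
  have "row_coord n (\<lambda>i j. if i = j then 1 else 0) k w = (\<Sum>j<n. if j = k then w k else 0)"
    unfolding row_coord_def by (intro sum.cong) (auto simp: nmat_adj_delta assms)
  then show ?thesis using assms by simp
qed

text \<open>Line i < 3 is spanned by e_i and e_(i+3), the fourth by (1,1,1,0,1,2) and (0,0,0,1,1,1),
  and M by e_0, e_1, e_2. Then x_i = e_i + i e_(i+3) and y_i = e_(i+3), so the cubic is v (v + 1) (v
  + 2), with discriminant 4. In the matrices 0 to 3 all rows after the first coincide;
  \<open>generic_poly\<close> reads their first two rows.\<close>

definition special_flags :: flags where
  "special_flags j a c = (if j = 4 then (if a = c then 1 else 0)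
     else if j = 3 then (if a = 0 then (if c < 3 then 1 else of_nat (c - 3)) else (if c < 3 then 0 else 1))
     else (if a = 0 then (if j = c then 1 else 0) else (if j + 3 = c then 1 else 0)))"

lemma generic_poly_special: "generic_poly special_flags \<noteq> 0"
proof -
  have lm: "line_mat special_flags r c = (if r = c then 1 else 0)" if "r < 6" for r c
    using that by (auto simp: line_mat_def special_flags_def)
  note cong = nmat_cong[of 6 "line_mat special_flags" "\<lambda>i j. if i = j then 1 else 0", OF lm]
  have g4: "special_flags 4 = (\<lambda>i j. if i = j then 1 else 0)"
    by (simp add: special_flags_def fun_eq_iff)
  have fc: "fourth_coord special_flags e r = special_flags 3 e r" if "r < 6" for e r
    unfolding fourth_coord_def using row_coord_delta[OF that] by (simp add: row_coord_def cong)
  have pc: "part_coord special_flags e i k = (if i = k then special_flags 3 e (k + 3) else 0)" if "i < 3" "k < 3" for e i k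
    unfolding part_coord_def g4 using that
    by (simp add: row_coord_delta fourth_part_def cscale_apply fc) (auto simp: special_flags_def)
  have pm: "part_minor special_flags i = 1" if "i < 3" for i
    using that by (simp add: part_minor_def fc special_flags_def)
  have mix: "mix_det3 S (part_coord special_flags 0) (part_coord special_flags 1) =
      (if 0 \<in> S then 1 else 0) * (if 1 \<in> S then 1 else 1) * (if 2 \<in> S then 1 else 2)" for S
    unfolding mix_det3_def det3_def by (simp add: pc special_flags_def)
  have "pencil_coeff 0 (part_coord special_flags 0) (part_coord special_flags 1) = 0"
    "pencil_coeff 1 (part_coord special_flags 0) (part_coord special_flags 1) = 2"
    "pencil_coeff 2 (part_coord special_flags 0) (part_coord special_flags 1) = 3"
    "pencil_coeff 3 (part_coord special_flags 0) (part_coord special_flags 1) = 1"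
    unfolding pencil_coeff_simps mix by simp_all
  moreover have "nmat_det 6 (line_mat special_flags) = 1" by (simp only: cong nmat_det_delta)
  ultimately show ?thesis unfolding generic_poly_def by (simp add: pm cubic_disc_def)
qed

lemma generic_count_four_lines_and_plane: "generic_count 3 3 four_lines_and_plane 3"
proof -
  let ?V = "{..<5} \<times> {..<6} \<times> {..<6::nat}"
  \<comment> \<open>With the determinants as a factor of the certifying polynomial, its nonvanishing
    directly supplies \<open>nmat_det 6 (gs j) \<noteq> 0\<close>.\<close>
  let ?D = "\<lambda>x::nat \<times> nat \<times> nat \<Rightarrow> complex. \<Prod>j<5. nmat_det 6 (\<lambda>a b. x (j, a, b))"
  let ?G = "\<lambda>x::nat \<times> nat \<times> nat \<Rightarrow> complex. generic_poly (\<lambda>j a b. x (j, a, b))"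
  have D: "poly_fun ?V ?D" by (intro poly_fun_prod poly_fun_nmat_det pf_var) auto
  obtain w where w: "?D w \<noteq> 0" using exists_nmat_det_prod_nonzero[of 6 5] by auto
  have G: "?G (\<lambda>(j, a, b). special_flags j a b) \<noteq> 0" using generic_poly_special by simp
  \<comment> \<open>The two factors are nonzero at different points: the repeated rows of
    \<open>special_flags\<close> make \<open>?D\<close> vanish there.\<close>
  have ne: "\<exists>x. ?D x * ?G x \<noteq> 0"
    using poly_fun_mult_nonzero[OF D poly_fun_generic_poly, of w "\<lambda>(j, a, b). special_flags j a b"] w G by auto
  have c: "finite (schubert_inter 3 6 four_lines_and_plane (\<lambda>j. row_flag 6 (gs j))) \<and>
      card (schubert_inter 3 6 four_lines_and_plane (\<lambda>j. row_flag 6 (gs j))) = 3"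
    if "?D (\<lambda>(j, a, b). gs j a b) * ?G (\<lambda>(j, a, b). gs j a b) \<noteq> 0" for gs
    using generic_schubert_inter[of gs] that by auto
  have l: "length four_lines_and_plane = 5" and n: "3 + 3 = (6::nat)" by (simp_all add: four_lines_and_plane_def)
  show ?thesis
    unfolding generic_count_def Let_def l n
    by (rule exI[of _ "\<lambda>x. ?D x * ?G x"]) (use ne c pf_mult[OF D poly_fun_generic_poly] in blast)
qed

theorem mainTheorem10:
  shows "schubert_d 3 3 [pieri 3 2, pieri 3 2, pieri 3 2, pieri 3 2, pieri 3 1] = 3 \<and>
         SG 3 3 [pieri 3 2, pieri 3 2, pieri 3 2, pieri 3 2, pieri 3 1]"
proof -
  have d: "schubert_d 3 3 four_lines_and_plane = 3"
    unfolding schubert_d_def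
  proof (rule the_equality)
    fix N assume "generic_count 3 3 four_lines_and_plane N"
    then show "N = 3" using generic_count_four_lines_and_plane by (rule generic_count_unique)
  qed (rule generic_count_four_lines_and_plane)
  have l: "length four_lines_and_plane = 5" and n: "3 + 3 = (6::nat)" by (simp_all add: four_lines_and_plane_def)
  have "SG 3 3 four_lines_and_plane"
    unfolding SG_def Let_def l n d
    \<comment> \<open>The constant polynomial 1 suffices, since the osculating count holds for all
      distinct real parameters.\<close>
    by (rule exI[of _ "\<lambda>_. 1"]) (use osculating_schubert_inter in \<open>auto intro: pf_const\<close>)
  with d show ?thesis by (simp only: four_lines_and_plane_def)
qed

end
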